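(* Let $(X,\rho)$ be a separable and complete metric space. Then a set $T\subset\overline{\mathrm{Q}}(X)$ of hypermeasures is precompact (i.e. relatively compact in the norm topology of $\overline{\mathrm{Q}}(X)$) if and only if $T$ is bounded in norm and equiquasicontinuous.
   Context: Let $(X,\rho)$ be a metric space and $\mathcal{X}$ the $\sigma$-algebra of its Borel sets. Put $$\Phi=\Phi(X,\rho)=\{\varphi\in\mathbb{R}^X:\ \forall x,y\in X\ \ |\varphi(x)|\le 1 \text{ and } |\varphi(x)-\varphi(y)|\le\rho(x,y)\},$$ and $\mathrm{BL}=\mathrm{BL}(X,\rho)=\bigcup_{a>0}a\Phi$, the class of all bounded Lipschitz real functions on $X$. Let $\mathrm{Q}=\mathrm{Q}(X)$ be the vector space of all charges (finite signed measures) on $\mathcal{X}$; for $q\in\mathrm{Q}$ write $qf=\int_X f\,dq$ and $\|q\|=\|q\|_\rho=\sup_{\varphi\in\Phi}|q\varphi|$. When $X$ is separable and complete, $\|\cdot\|_\rho$ is a norm on $\mathrm{Q}$. The completion of $\mathrm{Q}$ with respect to this norm is denoted $\overline{\mathrm{Q}}=\overline{\mathrm{Q}}(X)$, its norm again by $\|\cdot\|$, and its elements are called hypermeasures. Every hypermeasure $t$ is regarded as a linear functional on $\mathrm{BL}$, with value at $\varphi\in\mathrm{BL}$ denoted $t\varphi$: if $q_n\in\mathrm{Q}$ and $q_n\to t$ in $\overline{\mathrm{Q}}$, then $t\varphi=\lim_n q_n\varphi$. A set $T$ is bounded if $\sup_{t\in T}\|t\|<\infty$. A set $T$ of linear functionals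 on $\mathrm{BL}(X)$ is called equiquasicontinuous if for any $\varepsilon>0$ there exists a neighborhood of zero $U\subset\mathbb{R}^X$ in the Tykhonov topology (the product topology, i.e. the topology of pointwise convergence) such that $\sup_{t\in T,\ \varphi\in U\cap\Phi}|t\varphi|<\varepsilon$. *)

theory Defs
  imports "HOL-Analysis.Analysis"
begin

section \<open>The completion of a real normed vector space\<close>

definition cauchy_eq :: "(nat \<Rightarrow> 'a::real_normed_vector) \<Rightarrow> (nat \<Rightarrow> 'a) \<Rightarrow> bool"
  where "cauchy_eq X Y \<longleftrightarrow> Cauchy X \<and> Cauchy Y \<and> (\<lambda>n. X n - Y n) \<longlonglongrightarrow> 0"

lemma Cauchy_const: "Cauchy (\<lambda>_. x :: 'a::real_normed_vector)"
  by (intro convergent_Cauchy convergent_const)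

lemma Cauchy_linear:
  assumes "bounded_linear f" "Cauchy X"
  shows "Cauchy (\<lambda>n. f (X n))"
  using bounded_linear.Cauchy[OF assms] .

lemma Cauchy_minus':
  assumes "Cauchy X"
  shows "Cauchy (\<lambda>n. - X n :: 'a::real_normed_vector)"
  by (rule Cauchy_linear[OF bounded_linear_minus[OF bounded_linear_ident] assms])

lemma Cauchy_scaleR':
  assumes "Cauchy X"
  shows "Cauchy (\<lambda>n. c *\<^sub>R X n :: 'a::real_normed_vector)"
  by (rule Cauchy_linear[OF bounded_linear_scaleR_right assms])

lemma cauchy_eq_refl: "Cauchy X \<Longrightarrow> cauchy_eq X X"
  by (simp add: cauchy_eq_def)

lemma part_equivp_cauchy_eq: "part_equivp (cauchy_eq :: (nat \<Rightarrow> 'a::real_normed_vector) \<Rightarrow> _)"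
proof (rule part_equivpI)
  have "cauchy_eq (\<lambda>_. 0 :: 'a) (\<lambda>_. 0)"
    by (simp add: cauchy_eq_def Cauchy_const)
  then show "\<exists>X. cauchy_eq X (X :: nat \<Rightarrow> 'a)" by blast
  show "symp (cauchy_eq :: (nat \<Rightarrow> 'a) \<Rightarrow> _)"
  proof (rule sympI)
    fix X Y :: "nat \<Rightarrow> 'a"
    assume "cauchy_eq X Y"
    then show "cauchy_eq Y X"
      unfolding cauchy_eq_def using tendsto_minus[of "\<lambda>n. X n - Y n" 0] by simp
  qed
  show "transp (cauchy_eq :: (nat \<Rightarrow> 'a) \<Rightarrow> _)"
  proof (rule transpI)
    fix X Y Z :: "nat \<Rightarrow> 'a"
    assume "cauchy_eq X Y" "cauchy_eq Y Z"
    then show "cauchy_eq X Z"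
      unfolding cauchy_eq_def using tendsto_add[of "\<lambda>n. X n - Y n" 0 _ "\<lambda>n. Y n - Z n" 0] by simp
  qed
qed

quotient_type (overloaded) 'a normed_completion = "nat \<Rightarrow> 'a::real_normed_vector" / partial: cauchy_eq
  by (rule part_equivp_cauchy_eq)

lemma Cauchy_norm:
  fixes X :: "nat \<Rightarrow> 'a::real_normed_vector"
  assumes "Cauchy X"
  shows "convergent (\<lambda>n. norm (X n))"
proof -
  have "Cauchy (\<lambda>n. norm (X n))"
  proof (rule CauchyI)
    fix e :: real assume "0 < e"
    then obtain M where "\<forall>m\<ge>M. \<forall>n\<ge>M. norm (X m - X n) < e"
      using CauchyD[OF assms] by blast
    then show "\<exists>M. \<forall>m\<ge>M. \<forall>n\<ge>M. norm (norm (X m) - norm (X n)) < e"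
      by (metis norm_triangle_ineq3 order_le_less_trans real_norm_def)
  qed
  then show ?thesis by (rule Cauchy_convergent)
qed

lemma Cauchy_norm_lim:
  fixes X :: "nat \<Rightarrow> 'a::real_normed_vector"
  assumes "Cauchy X"
  shows "(\<lambda>n. norm (X n)) \<longlonglongrightarrow> lim (\<lambda>n. norm (X n))"
  using Cauchy_norm[OF assms] by (simp add: convergent_LIMSEQ_iff)

lemma Cauchy_add':
  fixes X :: "nat \<Rightarrow> 'a::real_normed_vector"
  assumes "Cauchy X" "Cauchy Y"
  shows "Cauchy (\<lambda>n. X n + Y n)"
proof (rule CauchyI)
  fix e :: real assume "0 < e"
  then have e: "e / 2 > 0" by simp
  obtain M where M: "\<forall>m\<ge>M. \<forall>n\<ge>M. norm (X m - X n) < e/2"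
    using CauchyD[OF assms(1) e] by blast
  obtain N where N: "\<forall>m\<ge>N. \<forall>n\<ge>N. norm (Y m - Y n) < e/2"
    using CauchyD[OF assms(2) e] by blast
  have "norm (X m + Y m - (X n + Y n)) < e" if "m \<ge> max M N" "n \<ge> max M N" for m n
  proof -
    have "norm (X m - X n) < e/2" "norm (Y m - Y n) < e/2"
      using M N that by auto
    then show ?thesis
      using norm_triangle_ineq[of "X m - X n" "Y m - Y n"] by (simp add: algebra_simps)
  qed
  then show "\<exists>M. \<forall>m\<ge>M. \<forall>n\<ge>M. norm (X m + Y m - (X n + Y n)) < e" by blast
qed

instantiation normed_completion :: (real_normed_vector) real_normed_vector
begin

lift_definition zero_normed_completion :: "'a normed_completion" is "\<lambda>_. 0"
  by (simp add: cauchy_eq_def Cauchy_const)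

lift_definition plus_normed_completion :: "'a normed_completion \<Rightarrow> 'a normed_completion \<Rightarrow> 'a normed_completion"
  is "\<lambda>X Y n. X n + Y n"
proof -
  fix X X' Y Y' :: "nat \<Rightarrow> 'a"
  assume *: "cauchy_eq X X'" "cauchy_eq Y Y'"
  have "(\<lambda>n. (X n - X' n) + (Y n - Y' n)) \<longlonglongrightarrow> 0 + 0"
    using * unfolding cauchy_eq_def by (intro tendsto_add) auto
  then show "cauchy_eq (\<lambda>n. X n + Y n) (\<lambda>n. X' n + Y' n)"
    using * unfolding cauchy_eq_def by (auto intro: Cauchy_add' simp: algebra_simps)
qed

lift_definition uminus_normed_completion :: "'a normed_completion \<Rightarrow> 'a normed_completion" is "\<lambda>X n. - X n"
proof -
  fix X X' :: "nat \<Rightarrow> 'a"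
  assume *: "cauchy_eq X X'"
  have "(\<lambda>n. - (X n - X' n)) \<longlonglongrightarrow> - 0"
    using * unfolding cauchy_eq_def by (intro tendsto_minus) auto
  moreover have "- (X n - X' n) = - X n - - X' n" for n by simp
  ultimately show "cauchy_eq (\<lambda>n. - X n) (\<lambda>n. - X' n)"
    using * unfolding cauchy_eq_def by (simp add: Cauchy_minus' del: minus_diff_eq)
qed

definition minus_normed_completion :: "'a normed_completion \<Rightarrow> 'a normed_completion \<Rightarrow> 'a normed_completion"
  where "x - y = x + (- y)" for x y :: "'a normed_completion"

lift_definition scaleR_normed_completion :: "real \<Rightarrow> 'a normed_completion \<Rightarrow> 'a normed_completion" is "\<lambda>c X n. c *\<^sub>R X n"
proof -
  fix c and X X' :: "nat \<Rightarrow> 'a"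
  assume *: "cauchy_eq X X'"
  then show "cauchy_eq (\<lambda>n. c *\<^sub>R X n) (\<lambda>n. c *\<^sub>R X' n)"
    using tendsto_scaleR[of "\<lambda>_. c" c _ "\<lambda>n. X n - X' n" 0]
    unfolding cauchy_eq_def
    by (auto intro: Cauchy_scaleR' simp: scaleR_diff_right)
qed

lift_definition norm_normed_completion :: "'a normed_completion \<Rightarrow> real" is "\<lambda>X. lim (\<lambda>n. norm (X n))"
proof -
  fix X X' :: "nat \<Rightarrow> 'a"
  assume *: "cauchy_eq X X'"
  have "(\<lambda>n. norm (X n) - norm (X' n)) \<longlonglongrightarrow> 0"
  proof (rule Lim_null_comparison)
    show "(\<lambda>n. norm (X n - X' n)) \<longlonglongrightarrow> 0"
      using * by (simp add: cauchy_eq_def tendsto_norm_zero)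
    show "\<forall>\<^sub>F n in sequentially. norm (norm (X n) - norm (X' n)) \<le> norm (X n - X' n)"
      by (simp add: norm_triangle_ineq3)
  qed
  moreover have "(\<lambda>n. norm (X n) - norm (X' n)) \<longlonglongrightarrow> lim (\<lambda>n. norm (X n)) - lim (\<lambda>n. norm (X' n))"
    using * unfolding cauchy_eq_def by (intro tendsto_diff Cauchy_norm_lim) auto
  ultimately show "lim (\<lambda>n. norm (X n)) = lim (\<lambda>n. norm (X' n))"
    using LIMSEQ_unique by fastforce
qed

definition dist_normed_completion :: "'a normed_completion \<Rightarrow> 'a normed_completion \<Rightarrow> real"
  where "dist x y = norm (x - y)" for x y :: "'a normed_completion"

definition sgn_normed_completion :: "'a normed_completion \<Rightarrow> 'a normed_completion"
  where "sgn x = inverse (norm x) *\<^sub>R x" for x :: "'a normed_completion"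

definition uniformity_normed_completion :: "('a normed_completion \<times> 'a normed_completion) filter"
  where "uniformity_normed_completion = (INF e\<in>{0<..}. principal {(x, y). dist x y < e})"

definition open_normed_completion :: "'a normed_completion set \<Rightarrow> bool"
  where "open_normed_completion U = (\<forall>x\<in>U. \<forall>\<^sub>F (x', y) in uniformity. x' = x \<longrightarrow> y \<in> U)"

instance
proof
  fix x y z :: "'a normed_completion" and a b :: real
  show "x + y + z = x + (y + z)"
    by transfer (auto simp: algebra_simps cauchy_eq_def intro!: Cauchy_add')
  show "x + y = y + x"
    by transfer (auto simp: algebra_simps cauchy_eq_def intro!: Cauchy_add')
  show "0 + x = x"
    by transfer (auto simp: cauchy_eq_def)
  show "- x + x = 0"
    by transfer (auto simp: cauchy_eq_def Cauchy_const)
  show "x - y = x + - y"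
    by (rule minus_normed_completion_def)
  show "a *\<^sub>R (x + y) = a *\<^sub>R x + a *\<^sub>R y"
    by transfer (auto simp: cauchy_eq_def scaleR_add_right intro!: Cauchy_add' Cauchy_scaleR')
  show "(a + b) *\<^sub>R x = a *\<^sub>R x + b *\<^sub>R x"
    by transfer (auto simp: cauchy_eq_def scaleR_add_left intro!: Cauchy_add' Cauchy_scaleR')
  show "a *\<^sub>R b *\<^sub>R x = (a * b) *\<^sub>R x"
    by transfer (auto simp: cauchy_eq_def intro!: Cauchy_scaleR')
  show "1 *\<^sub>R x = x"
    by transfer (auto simp: cauchy_eq_def)
  show "dist x y = norm (x - y)"
    by (rule dist_normed_completion_def)
  show "sgn x = inverse (norm x) *\<^sub>R x"
    by (rule sgn_normed_completion_def)
  show "uniformity = (INF e\<in>{0<..}. principal {(x, y :: 'a normed_completion). dist x y < e})"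
    by (rule uniformity_normed_completion_def)
  show "open U \<longleftrightarrow> (\<forall>x\<in>U. \<forall>\<^sub>F (x', y) in uniformity. x' = x \<longrightarrow> y \<in> U)" for U :: "'a normed_completion set"
    by (rule open_normed_completion_def)
  show "norm x = 0 \<longleftrightarrow> x = 0"
  proof transfer
    fix X :: "nat \<Rightarrow> 'a" assume X: "cauchy_eq X X"
    then have "(\<lambda>n. norm (X n)) \<longlonglongrightarrow> lim (\<lambda>n. norm (X n))"
      by (simp add: cauchy_eq_def Cauchy_norm_lim)
    moreover have "cauchy_eq X (\<lambda>_. 0) \<longleftrightarrow> (\<lambda>n. norm (X n)) \<longlonglongrightarrow> 0"
      using X by (simp add: cauchy_eq_def Cauchy_const tendsto_norm_zero_iff)
    ultimately show "lim (\<lambda>n. norm (X n)) = 0 \<longleftrightarrow> cauchy_eq X (\<lambda>_. 0)"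
      using LIMSEQ_unique by fastforce
  qed
  show "norm (x + y) \<le> norm x + norm y"
  proof transfer
    fix X Y :: "nat \<Rightarrow> 'a" assume "cauchy_eq X X" "cauchy_eq Y Y"
    then have "Cauchy X" "Cauchy Y" by (auto simp: cauchy_eq_def)
    then have "(\<lambda>n. norm (X n + Y n)) \<longlonglongrightarrow> lim (\<lambda>n. norm (X n + Y n))"
      and "(\<lambda>n. norm (X n) + norm (Y n)) \<longlonglongrightarrow> lim (\<lambda>n. norm (X n)) + lim (\<lambda>n. norm (Y n))"
      by (auto intro!: Cauchy_norm_lim Cauchy_add' tendsto_add)
    then show "lim (\<lambda>n. norm (X n + Y n)) \<le> lim (\<lambda>n. norm (X n)) + lim (\<lambda>n. norm (Y n))"
      by (rule LIMSEQ_le) (auto intro: norm_triangle_ineq)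
  qed
  show "norm (a *\<^sub>R x) = \<bar>a\<bar> * norm x"
  proof transfer
    fix a and X :: "nat \<Rightarrow> 'a" assume "cauchy_eq X X"
    then have "Cauchy X" by (auto simp: cauchy_eq_def)
    then have "(\<lambda>n. \<bar>a\<bar> * norm (X n)) \<longlonglongrightarrow> \<bar>a\<bar> * lim (\<lambda>n. norm (X n))"
      by (intro tendsto_mult tendsto_const Cauchy_norm_lim)
    then show "lim (\<lambda>n. norm (a *\<^sub>R X n)) = \<bar>a\<bar> * lim (\<lambda>n. norm (X n))"
      by (simp add: limI)
  qed
qed

end

lift_definition to_normed_completion :: "'a::real_normed_vector \<Rightarrow> 'a normed_completion" is "\<lambda>x _. x"
  by (simp add: cauchy_eq_def Cauchy_const)

lemma norm_to_normed_completion [simp]: "norm (to_normed_completion x) = norm x"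
  by transfer (simp add: limI)

lemma linear_to_normed_completion: "linear to_normed_completion"
proof (rule linearI)
  show "to_normed_completion (x + y) = to_normed_completion x + to_normed_completion y" for x y :: 'a
    by transfer (simp add: cauchy_eq_def Cauchy_const)
  show "to_normed_completion (c *\<^sub>R x) = c *\<^sub>R to_normed_completion x" for c and x :: 'a
    by transfer (simp add: cauchy_eq_def Cauchy_const)
qed

lemma dist_to_normed_completion [simp]: "dist (to_normed_completion x) (to_normed_completion y) = dist x y"
  by (metis dist_norm linear_diff linear_to_normed_completion norm_to_normed_completion)

lemma normed_completion_approx:
  assumes X: "Cauchy X"
  shows "(\<lambda>n. to_normed_completion (X n)) \<longlonglongrightarrow> abs_normed_completion X"
proof (rule LIMSEQ_I)
  fix e :: real assume "0 < e"
  then obtain M where M: "\<And>m n. m \<ge> M \<Longrightarrow> n \<ge> M \<Longrightarrow> norm (X m - X n) < e / 2"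
    using CauchyD[OF X, of "e/2"] by auto
  have "norm (to_normed_completion (X n) - abs_normed_completion X) < e" if n: "n \<ge> M" for n
  proof -
    have C: "Cauchy (\<lambda>m. X n - X m)"
    proof (rule CauchyI)
      fix e :: real assume "0 < e"
      from CauchyD[OF X this] show "\<exists>M. \<forall>m\<ge>M. \<forall>k\<ge>M. norm (X n - X m - (X n - X k)) < e"
        by (simp add: norm_minus_commute)
    qed
    have C': "Cauchy (\<lambda>m. - X m)"
      using X by (rule Cauchy_minus')
    have "to_normed_completion (X n) - abs_normed_completion X = abs_normed_completion (\<lambda>m. X n - X m)"
      unfolding minus_normed_completion_def to_normed_completion.abs_eq
      by (simp add: uminus_normed_completion.abs_eq plus_normed_completion.abs_eq cauchy_eq_refl X C' Cauchy_const)
    then have "norm (to_normed_completion (X n) - abs_normed_completion X) = lim (\<lambda>m. norm (X n - X m))"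
      by (simp add: norm_normed_completion.abs_eq cauchy_eq_refl C)
    also have "\<dots> \<le> e / 2"
    proof (rule LIMSEQ_le_const2[OF Cauchy_norm_lim[OF C]])
      show "\<exists>N. \<forall>m\<ge>N. norm (X n - X m) \<le> e / 2"
        using M n less_imp_le by blast
    qed
    also have "\<dots> < e" using \<open>0 < e\<close> by simp
    finally show ?thesis .
  qed
  then show "\<exists>no. \<forall>n\<ge>no. norm (to_normed_completion (X n) - abs_normed_completion X) < e" by blast
qed

lemma normed_completion_seq:
  obtains X where "(\<lambda>n. to_normed_completion (X n)) \<longlonglongrightarrow> (t :: 'a::real_normed_vector normed_completion)"
proof -
  have "\<exists>X. Cauchy X \<and> t = abs_normed_completion X"
    by (induction t rule: normed_completion.abs_induct) (auto simp: cauchy_eq_def)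
  then obtain X where "Cauchy X" "t = abs_normed_completion X" by blast
  then show ?thesis using normed_completion_approx[of X] that[of X] by simp
qed

lemma closure_range_to_normed_completion:
  "closure (range (to_normed_completion :: 'a::real_normed_vector \<Rightarrow> _)) = UNIV"
proof -
  have "t \<in> closure (range to_normed_completion)" for t :: "'a normed_completion"
    unfolding closure_sequential
  proof -
    obtain X where "(\<lambda>n. to_normed_completion (X n)) \<longlonglongrightarrow> t"
      by (rule normed_completion_seq)
    then show "\<exists>x. (\<forall>n. x n \<in> range to_normed_completion) \<and> x \<longlonglongrightarrow> t"
      by (intro exI[of _ "\<lambda>n. to_normed_completion (X n)"]) simp
  qed
  then show ?thesis by blast
qed

instance normed_completion :: (real_normed_vector) banach
proof
  fix S :: "nat \<Rightarrow> 'a normed_completion"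
  assume S: "Cauchy S"
  have "\<exists>x. dist (to_normed_completion x) (S n) < 1 / Suc n" for n
  proof -
    have "S n \<in> closure (range to_normed_completion)"
      by (simp add: closure_range_to_normed_completion)
    then have "\<exists>y\<in>range to_normed_completion. dist y (S n) < 1 / Suc n"
      unfolding closure_approachable by simp
    then show ?thesis by blast
  qed
  then obtain q where q: "\<And>n. dist (to_normed_completion (q n)) (S n) < 1 / Suc n" by metis
  have lim: "(\<lambda>n. to_normed_completion (q n) - S n) \<longlonglongrightarrow> 0"
    by (rule Lim_null_comparison[OF _ LIMSEQ_Suc[OF lim_1_over_n]])
      (use q in \<open>auto simp: dist_norm intro!: always_eventually less_imp_le\<close>)
  have "Cauchy (\<lambda>n. S n + (to_normed_completion (q n) - S n))"
    by (rule Cauchy_add'[OF S convergent_Cauchy]) (use lim in \<open>auto simp: convergent_def\<close>)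
  then have "Cauchy (\<lambda>n. to_normed_completion (q n))" by simp
  then have "Cauchy q" by (simp add: Cauchy_def)
  then have "(\<lambda>n. to_normed_completion (q n)) \<longlonglongrightarrow> abs_normed_completion q"
    by (rule normed_completion_approx)
  from tendsto_diff[OF this lim] have "S \<longlonglongrightarrow> abs_normed_completion q" by simp
  then show "convergent S" by (auto simp: convergent_def)
qed

section \<open>Charges\<close>

typedef (overloaded) ('a::topological_space) charge =
  "{q :: 'a set \<Rightarrow> real.
     (\<forall>A. range A \<subseteq> sets borel \<longrightarrow> disjoint_family A \<longrightarrow> (\<lambda>n::nat. q (A n)) sums q (\<Union>n. A n)) \<and>
     (\<forall>A. A \<notin> sets borel \<longrightarrow> q A = 0)}"
  morphisms apply_charge Abs_charge
  by (rule exI[of _ "\<lambda>_. 0"]) simp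

setup_lifting type_definition_charge

instantiation charge :: (topological_space) real_vector
begin

lift_definition zero_charge :: "'a charge" is "\<lambda>_. 0" by simp

lift_definition plus_charge :: "'a charge \<Rightarrow> 'a charge \<Rightarrow> 'a charge" is "\<lambda>p q A. p A + q A"
  by (auto intro: sums_add)

lift_definition uminus_charge :: "'a charge \<Rightarrow> 'a charge" is "\<lambda>q A. - q A"
  by (auto intro: sums_minus)

lift_definition minus_charge :: "'a charge \<Rightarrow> 'a charge \<Rightarrow> 'a charge" is "\<lambda>p q A. p A - q A"
  by (auto intro: sums_diff)

lift_definition scaleR_charge :: "real \<Rightarrow> 'a charge \<Rightarrow> 'a charge" is "\<lambda>c q A. c * q A"
  by (auto intro: sums_mult)

instance
  by standard (transfer; simp add: fun_eq_iff algebra_simps)+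

end

lemma charge_sums:
  assumes "range A \<subseteq> sets borel" "disjoint_family A"
  shows "(\<lambda>n::nat. apply_charge q (A n)) sums apply_charge q (\<Union>n. A n)"
  using assms by transfer simp

lemma charge_empty [simp]: "apply_charge q {} = 0"
proof -
  have "(\<lambda>n::nat. apply_charge q {}) sums apply_charge q (\<Union>n::nat. {})"
    by (rule charge_sums) (auto simp: disjoint_family_on_def)
  then have "(\<lambda>n::nat. apply_charge q {}) \<longlonglongrightarrow> 0"
    using summable_LIMSEQ_zero sums_summable by blast
  then show ?thesis by (simp add: LIMSEQ_const_iff)
qed

lemma charge_Un:
  assumes "A \<in> sets borel" "B \<in> sets borel" "A \<inter> B = {}"
  shows "apply_charge q (A \<union> B) = apply_charge q A + apply_charge q B"
proof -
  have "(\<lambda>n. apply_charge q (binaryset A B n)) sums apply_charge q (\<Union>n. binaryset A B n)"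
    by (rule charge_sums) (use assms in \<open>auto simp: disjoint_family_on_def binaryset_def\<close>)
  moreover have "(\<lambda>n. apply_charge q (binaryset A B n)) sums (apply_charge q A + apply_charge q B)"
    by (rule binaryset_sums) simp
  ultimately show ?thesis
    by (simp add: UN_binaryset_eq sums_unique2)
qed

lemma charge_Diff:
  assumes "A \<in> sets borel" "B \<in> sets borel" "B \<subseteq> A"
  shows "apply_charge q (A - B) = apply_charge q A - apply_charge q B"
proof -
  have "apply_charge q (B \<union> (A - B)) = apply_charge q B + apply_charge q (A - B)"
    by (rule charge_Un) (use assms in auto)
  moreover have "B \<union> (A - B) = A" using assms by auto
  ultimately show ?thesis by simp
qed

lemma charge_eqI:
  "(\<And>A. A \<in> sets borel \<Longrightarrow> apply_charge p A = apply_charge q A) \<Longrightarrow> p = q"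
  by transfer (metis ext)

text \<open>
  The positive part \<open>q\<^sup>+\<close> of the Jordan decomposition \<open>q = q\<^sup>+ - q\<^sup>-\<close>; the negative part
  is \<open>q\<^sup>- = (-q)\<^sup>+\<close>. Negative values of \<open>q\<close> are truncated to \<open>0\<close> by \<open>ennreal\<close>, which
  does not affect the supremum as \<open>q\<close> vanishes on the empty set.
\<close>

definition pos_var :: "'a::topological_space charge \<Rightarrow> 'a set \<Rightarrow> ennreal"
  where "pos_var q A = (SUP B\<in>{B \<in> sets borel. B \<subseteq> A}. ennreal (apply_charge q B))"

definition pos_part :: "'a::topological_space charge \<Rightarrow> 'a measure"
  where "pos_part q = measure_of UNIV (sets borel) (pos_var q)"

definition charge_integral :: "'a::topological_space charge \<Rightarrow> ('a \<Rightarrow> real) \<Rightarrow> real"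
  where "charge_integral q f = integral\<^sup>L (pos_part q) f - integral\<^sup>L (pos_part (- q)) f"

lemma space_pos_part [simp]: "space (pos_part q) = UNIV"
  by (simp add: pos_part_def space_measure_of_conv)

lemma sets_pos_part [simp, measurable_cong]:
  "sets (pos_part (q :: 'a::topological_space charge)) = sets borel"
  unfolding pos_part_def
  by (metis sets.sets_measure_of_eq sets_measure_of_conv space_borel sets.space_closed)

lemma pos_var_mono: "A \<subseteq> B \<Longrightarrow> pos_var q A \<le> pos_var q B"
  unfolding pos_var_def by (rule SUP_subset_mono) auto

lemma pos_var_upper: "B \<in> sets borel \<Longrightarrow> B \<subseteq> A \<Longrightarrow> ennreal (apply_charge q B) \<le> pos_var q A"
  unfolding pos_var_def by (rule SUP_upper) auto

lemma pos_var_Un_ge: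
  fixes q :: "'a::topological_space charge"
  assumes "A \<in> sets borel" "B \<in> sets borel" "A \<inter> B = {}"
  shows "pos_var q A + pos_var q B \<le> pos_var q (A \<union> B)"
proof -
  have "ennreal (apply_charge q C) + ennreal (apply_charge q D) \<le> pos_var q (A \<union> B)"
    if C: "C \<in> sets borel" "C \<subseteq> A" and D: "D \<in> sets borel" "D \<subseteq> B" for C D
  proof -
    have *: "apply_charge q (C \<union> D) = apply_charge q C + apply_charge q D"
      by (rule charge_Un) (use assms that in auto)
    have "ennreal (apply_charge q C) + ennreal (apply_charge q D) \<le> ennreal (apply_charge q (C \<union> D))"
      if "apply_charge q C \<ge> 0" "apply_charge q D \<ge> 0"
      using that * by simp
    moreover have "ennreal (apply_charge q (C \<union> D)) \<le> pos_var q (A \<union> B)"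
      "ennreal (apply_charge q C) \<le> pos_var q (A \<union> B)"
      "ennreal (apply_charge q D) \<le> pos_var q (A \<union> B)"
      by (rule pos_var_upper; use C D in auto)+
    ultimately show ?thesis
      by (cases "apply_charge q C \<ge> 0"; cases "apply_charge q D \<ge> 0") (auto simp: ennreal_neg)
  qed
  note * = this
  have ne: "{C \<in> sets borel. C \<subseteq> E} \<noteq> {}" for E :: "'a set" by blast
  have "pos_var q A + ennreal (apply_charge q D) \<le> pos_var q (A \<union> B)"
    if "D \<in> sets borel" "D \<subseteq> B" for D
    unfolding pos_var_def[of q A] ennreal_SUP_add_left[OF ne, symmetric]
    by (rule SUP_least) (use * that in blast)
  then show ?thesis
    unfolding pos_var_def[of q B] ennreal_SUP_add_right[OF ne]
    by (intro SUP_least) blast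
qed

lemma pos_var_sum_le:
  assumes "range A \<subseteq> sets borel" "disjoint_family A"
  shows "(\<Sum>i<n::nat. pos_var q (A i)) \<le> pos_var q (\<Union>i<n. A i)"
proof (induction n)
  case (Suc n)
  have "(\<Sum>i<Suc n. pos_var q (A i)) \<le> pos_var q (\<Union>i<n. A i) + pos_var q (A n)"
    using Suc by (simp add: add_right_mono)
  also have "\<dots> \<le> pos_var q ((\<Union>i<n. A i) \<union> A n)"
  proof (rule pos_var_Un_ge)
    show "(\<Union>i<n. A i) \<inter> A n = {}"
    proof -
      have "A i \<inter> A n = {}" if "i < n" for i
        using assms(2) that by (simp add: disjoint_family_on_def)
      then show ?thesis by blast
    qed
  qed (use assms in auto)
  also have "(\<Union>i<n. A i) \<union> A n = (\<Union>i<Suc n. A i)"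
    by (auto simp: less_Suc_eq)
  finally show ?case .
qed simp

lemma countably_additive_pos_var:
  "countably_additive (sets borel) (pos_var (q :: 'a::topological_space charge))"
proof (rule countably_additiveI)
  fix A :: "nat \<Rightarrow> 'a set"
  assume A: "range A \<subseteq> sets borel" "disjoint_family A" "(\<Union>i. A i) \<in> sets borel"
  show "(\<Sum>i. pos_var q (A i)) = pos_var q (\<Union>i. A i)"
  proof (rule antisym)
    show "(\<Sum>i. pos_var q (A i)) \<le> pos_var q (\<Union>i. A i)"
    proof (rule suminf_le_const)
      show "(\<Sum>i<n. pos_var q (A i)) \<le> pos_var q (\<Union>i. A i)" for n
        using pos_var_sum_le[OF A(1,2), of q n] pos_var_mono[of "\<Union>i<n. A i" "\<Union>i. A i" q]
        by (meson UN_subset_iff UN_upper order_trans iso_tuple_UNIV_I)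
    qed simp
    show "pos_var q (\<Union>i. A i) \<le> (\<Sum>i. pos_var q (A i))"
      unfolding pos_var_def[of q "\<Union>i. A i"]
    proof (rule SUP_least)
      fix B assume "B \<in> {B \<in> sets borel. B \<subseteq> (\<Union>i. A i)}"
      then have B: "B \<in> sets borel" "B \<subseteq> (\<Union>i. A i)" by auto
      have BA: "(\<lambda>i. apply_charge q (B \<inter> A i)) sums apply_charge q (\<Union>i. B \<inter> A i)"
        by (rule charge_sums) (use A B in \<open>auto simp: disjoint_family_on_def\<close>)
      moreover have "(\<Union>i. B \<inter> A i) = B" using B by auto
      ultimately have lim: "(\<lambda>n. \<Sum>i<n. apply_charge q (B \<inter> A i)) \<longlonglongrightarrow> apply_charge q B"
        by (simp add: sums_def)
      show "ennreal (apply_charge q B) \<le> (\<Sum>i. pos_var q (A i))"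
      proof (rule LIMSEQ_le_const2[OF tendsto_ennrealI[OF lim]], intro exI allI impI)
        fix n :: nat
        have "ennreal (\<Sum>i<n. apply_charge q (B \<inter> A i)) \<le> ennreal (\<Sum>i<n. max 0 (apply_charge q (B \<inter> A i)))"
          by (intro ennreal_leI sum_mono) simp
        also have "\<dots> = (\<Sum>i<n. ennreal (apply_charge q (B \<inter> A i)))"
          by (subst sum_ennreal[symmetric]) (auto simp: ennreal_max_0 intro!: sum.cong)
        also have "\<dots> \<le> (\<Sum>i<n. pos_var q (A i))"
          by (intro sum_mono pos_var_upper) (use A B in auto)
        also have "\<dots> \<le> (\<Sum>i. pos_var q (A i))"
          by (rule sum_le_suminf) auto
        finally show "ennreal (\<Sum>i<n. apply_charge q (B \<inter> A i)) \<le> (\<Sum>i. pos_var q (A i))" .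
      qed
    qed
  qed
qed

lemma pos_var_empty [simp]: "pos_var q {} = 0"
proof -
  have "{B \<in> sets borel. B \<subseteq> {}} = {{} :: 'a::topological_space set}" by auto
  then show ?thesis unfolding pos_var_def by simp
qed

lemma emeasure_pos_part:
  assumes "A \<in> sets borel"
  shows "emeasure (pos_part q) A = pos_var q A"
proof (rule emeasure_measure_of[OF pos_part_def])
  show "positive (sets (pos_part q)) (pos_var q)" by (simp add: positive_def)
qed (use assms countably_additive_pos_var in auto)

lemma pos_var_finite:
  fixes q :: "'a::topological_space charge"
  shows "pos_var q UNIV < \<infinity>"
proof (rule ccontr)
  assume "\<not> pos_var q UNIV < \<infinity>"
  then have top: "pos_var q UNIV = \<infinity>" by (simp add: less_top[symmetric])
  define P where "P E \<longleftrightarrow> E \<in> sets borel \<and> pos_var q E = \<infinity>" for E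
  have step: "\<exists>F. P F \<and> F \<subseteq> E \<and> \<bar>apply_charge q (E - F)\<bar> \<ge> 1" if "P E" for E
  proof -
    have E: "E \<in> sets borel" "pos_var q E = \<infinity>" using that by (auto simp: P_def)
    have "ennreal (\<bar>apply_charge q E\<bar> + 1) < pos_var q E" using E by (simp add: less_top[symmetric])
    then obtain B where B: "B \<in> sets borel" "B \<subseteq> E"
      and "ennreal (\<bar>apply_charge q E\<bar> + 1) < ennreal (apply_charge q B)"
      unfolding pos_var_def less_SUP_iff by (elim bexE CollectE conjE)
    then have qB: "\<bar>apply_charge q E\<bar> + 1 < apply_charge q B"
      by (subst (asm) ennreal_less_iff) auto
    have qD: "apply_charge q (E - B) = apply_charge q E - apply_charge q B"
      using E B by (simp add: charge_Diff)
    have "pos_var q B + pos_var q (E - B) = \<infinity>"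
    proof -
      have "emeasure (pos_part q) B + emeasure (pos_part q) (E - B) = emeasure (pos_part q) (B \<union> (E - B))"
        by (rule plus_emeasure) (use E B in auto)
      moreover have "B \<union> (E - B) = E" using B by auto
      ultimately show ?thesis using E B by (simp add: emeasure_pos_part)
    qed
    then consider "pos_var q B = \<infinity>" | "pos_var q (E - B) = \<infinity>" by auto
    then show ?thesis
    proof cases
      case 1
      then show ?thesis
        by (intro exI[of _ B]) (use B qB qD in \<open>auto simp: P_def\<close>)
    next
      case 2
      moreover have "E - (E - B) = B" using B by auto
      ultimately show ?thesis
        by (intro exI[of _ "E - B"]) (use E B qB in \<open>auto simp: P_def\<close>)
    qed
  qed
  then obtain g where g: "\<And>E. P E \<Longrightarrow> P (g E) \<and> g E \<subseteq> E \<and> \<bar>apply_charge q (E - g E)\<bar> \<ge> 1"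
    by metis
  define E where "E n = (g ^^ n) UNIV" for n
  have PE: "P (E n)" for n
    by (induction n) (use top g in \<open>auto simp: E_def P_def\<close>)
  have dec: "E (Suc n) \<subseteq> E n" and ge: "\<bar>apply_charge q (E n - E (Suc n))\<bar> \<ge> 1" for n
    using g[OF PE[of n]] by (auto simp: E_def)
  have anti: "E n \<subseteq> E m" if "m \<le> n" for m n
    using lift_Suc_antimono_le[of E] dec that by auto
  have "disjoint_family (\<lambda>n. E n - E (Suc n))"
  proof -
    have "(E m - E (Suc m)) \<inter> (E n - E (Suc n)) = {}" if "m < n" for m n
      using anti[of "Suc m" n] that by auto
    then show ?thesis
      unfolding disjoint_family_on_def by (metis inf_commute linorder_neqE_nat)
  qed
  moreover have "range (\<lambda>n. E n - E (Suc n)) \<subseteq> sets borel"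
    using PE by (auto simp: P_def)
  ultimately have "summable (\<lambda>n. apply_charge q (E n - E (Suc n)))"
    using charge_sums sums_summable by blast
  then have "(\<lambda>n. apply_charge q (E n - E (Suc n))) \<longlonglongrightarrow> 0"
    by (rule summable_LIMSEQ_zero)
  from LIMSEQ_D[OF this zero_less_one] obtain N
    where "\<bar>apply_charge q (E N - E (Suc N))\<bar> < 1" by auto
  with ge[of N] show False by simp
qed

lemma finite_measure_pos_part: "finite_measure (pos_part q)"
  by (rule finite_measureI) (use pos_var_finite[of q] in \<open>auto simp: emeasure_pos_part\<close>)

lemma pos_part_eq:
  assumes A: "A \<in> sets borel"
  shows "pos_var q A = ennreal (measure (pos_part q) A)"
  using finite_measure.emeasure_eq_measure[OF finite_measure_pos_part, of q A] A
  by (simp add: emeasure_pos_part)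

lemma jordan_decomposition:
  fixes q :: "'a::topological_space charge"
  assumes A: "A \<in> sets borel"
  shows "apply_charge q A = measure (pos_part q) A - measure (pos_part (- q)) A"
proof -
  have upper: "apply_charge q A + measure (pos_part (- q)) A \<le> measure (pos_part q) A"
    if A: "A \<in> sets borel" for q :: "'a charge" and A
  proof -
    have le: "apply_charge q B \<le> measure (pos_part q) A" if B: "B \<in> sets borel" "B \<subseteq> A" for B
    proof -
      have "ennreal (apply_charge q B) \<le> ennreal (measure (pos_part q) A)"
        using pos_var_upper[OF B, of q] pos_part_eq[OF A] by metis
      then show ?thesis by (simp add: ennreal_le_iff2) (meson measure_nonneg order_trans linear)
    qed
    have "pos_var (- q) A \<le> ennreal (measure (pos_part q) A - apply_charge q A)"
      unfolding pos_var_def[of "- q"]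
    proof (rule SUP_least)
      fix B assume "B \<in> {B \<in> sets borel. B \<subseteq> A}"
      then have B: "B \<in> sets borel" "B \<subseteq> A" by auto
      have "apply_charge (- q) B = apply_charge q (A - B) - apply_charge q A"
        using A B by (simp add: charge_Diff uminus_charge.rep_eq)
      also have "\<dots> \<le> measure (pos_part q) A - apply_charge q A"
        using le[of "A - B"] A B by auto
      finally show "ennreal (apply_charge (- q) B) \<le> ennreal (measure (pos_part q) A - apply_charge q A)"
        by (rule ennreal_leI)
    qed
    then show ?thesis
      using le[of A] A by (simp add: pos_part_eq)
  qed
  show ?thesis
    using upper[OF A, of q] upper[OF A, of "- q"] by (simp add: uminus_charge.rep_eq)
qed

section \<open>The norm on the space of charges\<close>

definition Phi :: "('a::metric_space \<Rightarrow> real) set"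
  where "Phi = {\<phi>. \<forall>x y. \<bar>\<phi> x\<bar> \<le> 1 \<and> \<bar>\<phi> x - \<phi> y\<bar> \<le> dist x y}"

definition BL :: "('a::metric_space \<Rightarrow> real) set"
  where "BL = (\<Union>a\<in>{0<..}. (\<lambda>\<phi> x. a * \<phi> x) ` Phi)"

lemma Phi_borel_measurable:
  assumes "\<phi> \<in> Phi"
  shows "\<phi> \<in> borel_measurable borel"
proof (rule borel_measurable_continuous_onI)
  have "1-lipschitz_on UNIV \<phi>"
    using assms by (auto simp: Phi_def lipschitz_on_def dist_real_def)
  then show "continuous_on UNIV \<phi>" by (rule lipschitz_on_continuous_on)
qed

lemma integrable_pos_part:
  fixes f :: "'a::topological_space \<Rightarrow> real"
  assumes "f \<in> borel_measurable borel" "\<And>x. \<bar>f x\<bar> \<le> B"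
  shows "integrable (pos_part q) f"
  by (rule finite_measure.integrable_const_bound[OF finite_measure_pos_part, where B = B])
    (use assms in \<open>auto simp: measurable_cong_sets[OF sets_pos_part refl]\<close>)

lemma nn_integral_sum3:
  fixes M1 M2 M3 N1 N2 N3 :: "'a::topological_space measure"
  assumes sets: "sets M1 = sets borel" "sets M2 = sets borel" "sets M3 = sets borel"
    "sets N1 = sets borel" "sets N2 = sets borel" "sets N3 = sets borel"
    and eq: "\<And>A. A \<in> sets borel \<Longrightarrow>
      emeasure M1 A + emeasure M2 A + emeasure M3 A = emeasure N1 A + emeasure N2 A + emeasure N3 A"
    and u: "u \<in> borel_measurable (borel :: 'a measure)"
  shows "integral\<^sup>N M1 u + integral\<^sup>N M2 u + integral\<^sup>N M3 u =
         integral\<^sup>N N1 u + integral\<^sup>N N2 u + integral\<^sup>N N3 u"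
  using u
proof (induction rule: borel_measurable_induct)
  case (cong f g)
  then have "f = g" by auto
  then show ?case using cong by simp
next
  case (set A)
  then show ?case using eq sets by simp
next
  case (mult u c)
  have "integral\<^sup>N M (\<lambda>x. c * u x) = c * integral\<^sup>N M u"
    if "sets M = sets borel" for M :: "'a measure"
  proof (rule nn_integral_cmult)
    show "u \<in> borel_measurable M"
      using mult(2) unfolding measurable_cong_sets[OF that refl] .
  qed
  then show ?case
    using mult.IH by (simp only: sets distrib_left[symmetric])
next
  case (add u v)
  have "integral\<^sup>N M (\<lambda>x. v x + u x) = integral\<^sup>N M v + integral\<^sup>N M u"
    if "sets M = sets borel" for M :: "'a measure"
  proof (rule nn_integral_add)
    show "v \<in> borel_measurable M" "u \<in> borel_measurable M"
      using add.hyps(1,3) unfolding measurable_cong_sets[OF that refl] by auto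
  qed
  moreover have "(a1 + b1) + (a2 + b2) + (a3 + b3) = (a1 + a2 + a3) + (b1 + b2 + b3)"
    for a1 a2 a3 b1 b2 b3 :: ennreal
    by (metis (no_types, opaque_lifting) add.assoc add.left_commute)
  ultimately show ?case using add.IH by (simp only: sets)
next
  case (seq U)
  have *: "(\<integral>\<^sup>+x. (SUP i. U i x) \<partial>M) = (SUP i. integral\<^sup>N M (U i))"
    if "sets M = sets borel" for M :: "'a measure"
  proof (rule nn_integral_monotone_convergence_SUP)
    show "U i \<in> borel_measurable M" for i
      using seq.hyps(1)[of i] unfolding measurable_cong_sets[OF that refl] .
  qed (rule \<open>incseq U\<close>)
  have inc: "incseq (\<lambda>i. integral\<^sup>N M (U i))" for M
    using \<open>incseq U\<close> by (rule incseq_nn_integral)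
  have S: "(SUP i. U i) = (\<lambda>x. SUP i. U i x)" by (auto simp: fun_eq_iff image_comp)
  have sum: "(SUP i. integral\<^sup>N K1 (U i)) + (SUP i. integral\<^sup>N K2 (U i)) + (SUP i. integral\<^sup>N K3 (U i)) =
      (SUP i. integral\<^sup>N K1 (U i) + integral\<^sup>N K2 (U i) + integral\<^sup>N K3 (U i))" for K1 K2 K3
  proof -
    have "incseq (\<lambda>i. integral\<^sup>N K1 (U i) + integral\<^sup>N K2 (U i))"
      using inc[of K1] inc[of K2] by (auto simp: incseq_def intro!: add_mono)
    from ennreal_SUP_add[OF this inc[of K3]] ennreal_SUP_add[OF inc[of K1] inc[of K2]]
    show ?thesis by simp
  qed
  show ?case
    unfolding S by (simp only: * sets sum seq.IH)
qed

lemma charge_integral_sum3: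
  fixes p q r :: "'a::topological_space charge" and f :: "'a \<Rightarrow> real"
  assumes eq: "\<And>A. A \<in> sets borel \<Longrightarrow> apply_charge p A + apply_charge q A + apply_charge r A = 0"
    and f: "f \<in> borel_measurable borel" "\<And>x. \<bar>f x\<bar> \<le> B"
  shows "charge_integral p f + charge_integral q f + charge_integral r f = 0"
proof -
  have em: "emeasure (pos_part p) A + emeasure (pos_part q) A + emeasure (pos_part r) A =
      emeasure (pos_part (- p)) A + emeasure (pos_part (- q)) A + emeasure (pos_part (- r)) A"
    if "A \<in> sets borel" for A
    using eq[OF that] jordan_decomposition[OF that, of p] jordan_decomposition[OF that, of q]
      jordan_decomposition[OF that, of r]
    by (simp add: emeasure_pos_part pos_part_eq that flip: ennreal_plus)
  have N: "integral\<^sup>N (pos_part p) u + integral\<^sup>N (pos_part q) u + integral\<^sup>N (pos_part r) u =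
      integral\<^sup>N (pos_part (- p)) u + integral\<^sup>N (pos_part (- q)) u + integral\<^sup>N (pos_part (- r)) u"
    if "u \<in> borel_measurable borel" for u
    by (rule nn_integral_sum3) (use em that in auto)
  have fin: "integral\<^sup>N (pos_part s) (\<lambda>x. ennreal (g x)) = ennreal (enn2real (integral\<^sup>N (pos_part s) (\<lambda>x. ennreal (g x))))"
    if "g = f \<or> g = (\<lambda>x. - f x)" for s g
  proof -
    have "integral\<^sup>N (pos_part s) (\<lambda>x. ennreal (g x)) \<le> integral\<^sup>N (pos_part s) (\<lambda>x. ennreal B)"
      by (intro nn_integral_mono ennreal_leI) (use that f(2) in \<open>auto simp: abs_le_iff\<close>)
    also have "\<dots> < \<infinity>"
      using pos_var_finite[of s] by (auto simp: emeasure_pos_part ennreal_mult_less_top)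
    finally show ?thesis by simp
  qed
  let ?I = "\<lambda>s g. enn2real (integral\<^sup>N (pos_part s) (\<lambda>x. ennreal (g x)))"
  have R: "?I p g + ?I q g + ?I r g = ?I (- p) g + ?I (- q) g + ?I (- r) g"
    if g: "g = f \<or> g = (\<lambda>x. - f x)" for g
  proof -
    have "(\<lambda>x. ennreal (g x)) \<in> borel_measurable borel" using g f(1) by auto
    from N[OF this] have "ennreal (?I p g) + ennreal (?I q g) + ennreal (?I r g) =
        ennreal (?I (- p) g) + ennreal (?I (- q) g) + ennreal (?I (- r) g)"
      unfolding fin[OF g, symmetric] .
    then show ?thesis by (simp flip: ennreal_plus)
  qed
  have L: "integral\<^sup>L (pos_part s) f = ?I s f - ?I s (\<lambda>x. - f x)" for s
    by (rule real_lebesgue_integral_def) (rule integrable_pos_part[OF f])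
  show ?thesis
    using R[of f] R[of "\<lambda>x. - f x"] unfolding charge_integral_def L by simp
qed

lemma charge_integral_uminus: "charge_integral (- q) f = - charge_integral q f"
  by (simp add: charge_integral_def)

lemma charge_integral_add:
  fixes f :: "'a::topological_space \<Rightarrow> real"
  assumes f: "f \<in> borel_measurable borel" "\<And>x. \<bar>f x\<bar> \<le> B"
  shows "charge_integral (p + q) f = charge_integral p f + charge_integral q f"
proof -
  have "charge_integral p f + charge_integral q f + charge_integral (- (p + q)) f = 0"
    by (rule charge_integral_sum3[OF _ f]) (simp only: plus_charge.rep_eq uminus_charge.rep_eq; simp)
  then show ?thesis unfolding charge_integral_uminus by simp
qed

lemma charge_integral_zero: "charge_integral 0 f = 0"
  by (simp add: charge_integral_def)

lemma charge_integral_scaleR: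
  assumes f: "f \<in> borel_measurable borel"
  shows "charge_integral (c *\<^sub>R q) f = c * charge_integral q f"
proof -
  have pos: "pos_part (c *\<^sub>R q) = density (pos_part q) (\<lambda>_. ennreal c)" if "c > 0"
    for c and q :: "'a charge"
  proof (rule measure_eqI)
    fix A :: "'a set" assume "A \<in> sets (pos_part (c *\<^sub>R q))"
    then have A: "A \<in> sets borel" by simp
    have "pos_var (c *\<^sub>R q) A = ennreal c * pos_var q A"
      unfolding pos_var_def SUP_mult_left_ennreal using that
      by (simp add: scaleR_charge.rep_eq ennreal_mult')
    then show "emeasure (pos_part (c *\<^sub>R q)) A = emeasure (density (pos_part q) (\<lambda>_. ennreal c)) A"
      using A by (simp add: emeasure_pos_part emeasure_density_const)
  qed simp
  have int: "integral\<^sup>L (density (pos_part q) (\<lambda>_. ennreal c)) f = c * integral\<^sup>L (pos_part q) f"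
    if "c > 0" for c and q :: "'a charge"
    using that f by (subst integral_density) (auto simp: measurable_cong_sets[OF sets_pos_part refl])
  have gt: "charge_integral (c *\<^sub>R q) f = c * charge_integral q f" if "c > 0" for c and q :: "'a charge"
  proof -
    have "- (c *\<^sub>R q) = c *\<^sub>R (- q)" by simp
    then show ?thesis
      unfolding charge_integral_def using that by (simp only: pos int right_diff_distrib)
  qed
  consider "c > 0" | "c = 0" | "c < 0" by linarith
  then show ?thesis
  proof cases
    case 3
    then show ?thesis using gt[of "- c" "- q"] by (simp add: charge_integral_uminus)
  qed (simp_all add: gt charge_integral_zero)
qed

lemma charge_integral_cmult:
  "charge_integral q (\<lambda>x. c * f x) = c * charge_integral q f"
  by (simp add: charge_integral_def right_diff_distrib)

lemma charge_integral_bound: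
  assumes "\<phi> \<in> Phi"
  shows "\<bar>charge_integral q \<phi>\<bar> \<le> measure (pos_part q) UNIV + measure (pos_part (- q)) UNIV"
proof -
  have *: "\<bar>integral\<^sup>L (pos_part s) \<phi>\<bar> \<le> measure (pos_part s) UNIV" for s :: "'a charge"
  proof -
    interpret finite_measure "pos_part s" by (rule finite_measure_pos_part)
    have "\<bar>integral\<^sup>L (pos_part s) \<phi>\<bar> \<le> (\<integral>x. \<bar>\<phi> x\<bar> \<partial>pos_part s)"
      by (rule integral_abs_bound)
    also have "\<dots> \<le> (\<integral>x. 1 \<partial>pos_part s)"
      by (intro integral_mono integrable_abs integrable_pos_part[of _ 1] Phi_borel_measurable assms)
        (use assms in \<open>auto simp: Phi_def\<close>)
    finally show ?thesis by simp
  qed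
  show ?thesis
    unfolding charge_integral_def using *[of q] *[of "- q"] by linarith
qed

lemma bdd_above_charge_integral: "bdd_above ((\<lambda>\<phi>. \<bar>charge_integral q \<phi>\<bar>) ` Phi)"
  using charge_integral_bound by (auto intro!: bdd_aboveI)

lemma zero_in_Phi: "(\<lambda>_. 0) \<in> Phi"
  by (simp add: Phi_def)

lemma charge_integral_eq_0_imp:
  fixes q :: "'a::metric_space charge"
  assumes 0: "\<And>\<phi>. \<phi> \<in> Phi \<Longrightarrow> charge_integral q \<phi> = 0"
  shows "q = 0"
proof -
  have eq_open: "measure (pos_part q) U = measure (pos_part (- q)) U" if U: "open U" for U :: "'a set"
  proof -
    define f where "f k x = (if U = UNIV then 1 else min 1 (real (Suc k) * infdist x (- U)))" for k x
    have f1: "\<bar>f k x\<bar> \<le> 1" for k x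
      by (auto simp: f_def infdist_nonneg)
    have lip: "\<bar>f k x - f k y\<bar> \<le> real (Suc k) * dist x y" for k x y
    proof -
      have "\<bar>min 1 a - min 1 b\<bar> \<le> \<bar>a - b\<bar>" for a b :: real by linarith
      then have "\<bar>f k x - f k y\<bar> \<le> \<bar>real (Suc k) * infdist x (- U) - real (Suc k) * infdist y (- U)\<bar>"
        by (simp add: f_def)
      also have "\<dots> = real (Suc k) * \<bar>infdist x (- U) - infdist y (- U)\<bar>"
        by (simp only: right_diff_distrib[symmetric] abs_mult abs_of_nat)
      also have "\<dots> \<le> real (Suc k) * dist x y"
        by (intro mult_left_mono infdist_triangle_abs) simp
      finally show ?thesis .
    qed
    have Phi: "(\<lambda>x. inverse (real (Suc k)) * f k x) \<in> Phi" for k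
    proof -
      have "\<bar>inverse (real (Suc k)) * f k x\<bar> \<le> 1" for x
      proof -
        have "\<bar>inverse (real (Suc k)) * f k x\<bar> = inverse (real (Suc k)) * \<bar>f k x\<bar>"
          by (simp only: abs_mult) simp
        also have "\<dots> \<le> 1 * 1"
          by (intro mult_mono f1) (auto simp: field_simps)
        finally show ?thesis by simp
      qed
      moreover have "\<bar>inverse (real (Suc k)) * f k x - inverse (real (Suc k)) * f k y\<bar> \<le> dist x y" for x y
      proof -
        have "\<bar>inverse (real (Suc k)) * f k x - inverse (real (Suc k)) * f k y\<bar> =
            inverse (real (Suc k)) * \<bar>f k x - f k y\<bar>"
          by (simp only: right_diff_distrib[symmetric] abs_mult) simp
        also have "\<dots> \<le> inverse (real (Suc k)) * (real (Suc k) * dist x y)"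
          by (intro mult_left_mono lip) simp
        also have "\<dots> = dist x y"
          by (simp only: mult.assoc[symmetric]) simp
        finally show ?thesis .
      qed
      ultimately show ?thesis by (simp add: Phi_def)
    qed
    have fI: "charge_integral q (f k) = 0" for k
      using 0[OF Phi[of k]] unfolding charge_integral_cmult by simp
    have meas: "f k \<in> borel_measurable borel" for k
    proof -
      have "(\<lambda>x. real (Suc k) * (inverse (real (Suc k)) * f k x)) \<in> borel_measurable borel"
        by (intro borel_measurable_times borel_measurable_const Phi_borel_measurable[OF Phi])
      moreover have "real (Suc k) * (inverse (real (Suc k)) * f k x) = f k x" for x
        by (simp only: mult.assoc[symmetric]) simp
      ultimately show ?thesis by (simp only:)
    qed
    have lim: "(\<lambda>k. f k x) \<longlonglongrightarrow> indicator U x" for x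
    proof (cases "x \<in> U \<and> U \<noteq> UNIV")
      case True
      then have "infdist x (- U) > 0"
        using U by (intro infdist_pos_not_in_closed) auto
      then obtain n where n: "1 < real n * infdist x (- U)"
        using reals_Archimedean3 by blast
      have "f k x = 1" if "k \<ge> n" for k
      proof -
        have "real n * infdist x (- U) \<le> real (Suc k) * infdist x (- U)"
          using that by (intro mult_right_mono) (auto simp: infdist_nonneg)
        then show ?thesis using n True by (simp add: f_def)
      qed
      then have "eventually (\<lambda>k. f k x = 1) sequentially" by (auto simp: eventually_sequentially)
      then show ?thesis using True by (simp add: tendsto_eventually)
    next
      case False
      then have "f k x = indicator U x" for k
        by (auto simp: f_def indicator_def)
      then show ?thesis by simp
    qed
    have "(\<lambda>k. integral\<^sup>L (pos_part s) (f k)) \<longlonglongrightarrow> measure (pos_part s) U" for s :: "'a charge"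
    proof -
      interpret finite_measure "pos_part s" by (rule finite_measure_pos_part)
      have "(\<lambda>k. integral\<^sup>L (pos_part s) (f k)) \<longlonglongrightarrow> integral\<^sup>L (pos_part s) (indicator U)"
        by (rule integral_dominated_convergence[where w = "\<lambda>_. 1"])
          (use meas lim f1 U in \<open>auto simp: measurable_cong_sets[OF sets_pos_part refl]\<close>)
      then show ?thesis using U by simp
    qed
    note lims = this[of q] this[of "- q"]
    have "(\<lambda>k. integral\<^sup>L (pos_part q) (f k)) = (\<lambda>k. integral\<^sup>L (pos_part (- q)) (f k))"
      using fI by (simp add: charge_integral_def)
    then show ?thesis using lims LIMSEQ_unique by metis
  qed
  have "pos_part q = pos_part (- q)"
  proof (rule measure_eqI_generator_eq[where E = "{U :: 'a set. open U}" and \<Omega> = UNIV and A = "\<lambda>_. UNIV"])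
    show "emeasure (pos_part q) U = emeasure (pos_part (- q)) U" if "U \<in> {U. open U}" for U
      using that eq_open[of U] by (simp add: emeasure_pos_part pos_part_eq)
    show "emeasure (pos_part q) UNIV \<noteq> \<infinity>"
      by (simp add: emeasure_pos_part pos_part_eq)
  qed (auto simp: Int_stable_def borel_def)
  then show ?thesis
    by (intro charge_eqI) (simp add: jordan_decomposition[of _ q] zero_charge.rep_eq)
qed

instantiation charge :: (metric_space) real_normed_vector
begin

definition norm_charge :: "'a charge \<Rightarrow> real"
  where "norm q = (SUP \<phi>\<in>Phi. \<bar>charge_integral q \<phi>\<bar>)"

definition dist_charge :: "'a charge \<Rightarrow> 'a charge \<Rightarrow> real"
  where "dist p q = norm (p - q)" for p q :: "'a charge"

definition sgn_charge :: "'a charge \<Rightarrow> 'a charge"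
  where "sgn q = inverse (norm q) *\<^sub>R q" for q :: "'a charge"

definition uniformity_charge :: "('a charge \<times> 'a charge) filter"
  where "uniformity_charge = (INF e\<in>{0<..}. principal {(x, y). dist x y < e})"

definition open_charge :: "'a charge set \<Rightarrow> bool"
  where "open_charge U = (\<forall>x\<in>U. \<forall>\<^sub>F (x', y) in uniformity. x' = x \<longrightarrow> y \<in> U)"

instance
proof
  fix p q :: "'a charge" and c :: real
  show "dist p q = norm (p - q)"
    by (rule dist_charge_def)
  show "sgn q = inverse (norm q) *\<^sub>R q"
    by (rule sgn_charge_def)
  show "uniformity = (INF e\<in>{0<..}. principal {(x, y :: 'a charge). dist x y < e})"
    by (rule uniformity_charge_def)
  show "open U \<longleftrightarrow> (\<forall>x\<in>U. \<forall>\<^sub>F (x', y) in uniformity. x' = x \<longrightarrow> y \<in> U)" for U :: "'a charge set"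
    by (rule open_charge_def)
  have upper: "\<bar>charge_integral r \<phi>\<bar> \<le> norm r" if "\<phi> \<in> Phi" for r :: "'a charge" and \<phi>
    unfolding norm_charge_def by (rule cSUP_upper[OF that bdd_above_charge_integral])
  have least: "norm r \<le> B" if "\<And>\<phi>. \<phi> \<in> Phi \<Longrightarrow> \<bar>charge_integral r \<phi>\<bar> \<le> B" for r :: "'a charge" and B
    unfolding norm_charge_def by (rule cSUP_least) (use zero_in_Phi that in auto)
  show "norm q = 0 \<longleftrightarrow> q = 0"
  proof
    assume "norm q = 0"
    then show "q = 0"
      using upper[of _ q] by (intro charge_integral_eq_0_imp) force
  next
    assume "q = 0"
    then have "norm q \<le> 0" by (intro least) (simp add: charge_integral_zero)
    moreover have "norm q \<ge> 0" using upper[OF zero_in_Phi, of q] by linarith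
    ultimately show "norm q = 0" by linarith
  qed
  show "norm (p + q) \<le> norm p + norm q"
  proof (rule least)
    fix \<phi> :: "'a \<Rightarrow> real" assume "\<phi> \<in> Phi"
    then have "charge_integral (p + q) \<phi> = charge_integral p \<phi> + charge_integral q \<phi>"
      by (intro charge_integral_add[where B = 1]) (auto simp: Phi_borel_measurable Phi_def)
    then show "\<bar>charge_integral (p + q) \<phi>\<bar> \<le> norm p + norm q"
      using upper[OF \<open>\<phi> \<in> Phi\<close>, of p] upper[OF \<open>\<phi> \<in> Phi\<close>, of q] by linarith
  qed
  have le: "norm (c *\<^sub>R r) \<le> \<bar>c\<bar> * norm r" for c and r :: "'a charge"
    by (rule least) (auto simp: charge_integral_scaleR Phi_borel_measurable abs_mult intro!: mult_left_mono upper)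
  show "norm (c *\<^sub>R q) = \<bar>c\<bar> * norm q"
  proof (cases "c = 0")
    case True
    then show ?thesis using le[of 0 q] upper[OF zero_in_Phi, of "0 :: 'a charge"] by simp
  next
    case False
    have "norm (inverse c *\<^sub>R (c *\<^sub>R q)) \<le> \<bar>inverse c\<bar> * norm (c *\<^sub>R q)" by (rule le)
    then have "\<bar>c\<bar> * norm q \<le> norm (c *\<^sub>R q)"
      using False by (simp add: field_simps abs_inverse)
    then show ?thesis using le[of c q] by linarith
  qed
qed

end

section \<open>Hypermeasures\<close>

type_synonym 'a hypermeasure = "'a charge normed_completion"

text \<open>
  The value \<open>t \<phi>\<close> of a hypermeasure as a functional on \<open>BL\<close>: the common limit of \<open>q\<^sub>n \<phi>\<close> along
  all sequences of charges \<open>q\<^sub>n \<longlonglongrightarrow> t\<close> in the completion. By \<open>hyper_apply_eqI\<close> below it is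
  well-defined for \<open>\<phi> \<in> BL\<close>; it carries no meaning for other \<open>\<phi>\<close>.
\<close>

definition hyper_apply :: "'a::metric_space hypermeasure \<Rightarrow> ('a \<Rightarrow> real) \<Rightarrow> real"
  where "hyper_apply t \<phi> =
    (THE r. \<forall>q. (\<lambda>n. to_normed_completion (q n)) \<longlonglongrightarrow> t \<longrightarrow> (\<lambda>n. charge_integral (q n) \<phi>) \<longlonglongrightarrow> r)"

text \<open>
  The supremum is taken in \<open>ennreal\<close>, so that it is \<open>\<infinity>\<close> for unbounded and \<open>0\<close> for empty families.
\<close>

definition equiquasicontinuous :: "(('a::metric_space \<Rightarrow> real) \<Rightarrow> real) set \<Rightarrow> bool"
  where "equiquasicontinuous T \<longleftrightarrow>
    (\<forall>\<epsilon>>0. \<exists>U :: ('a \<Rightarrow> real) set. (\<lambda>_. 0) \<in> interior U \<and>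
      (SUP t\<in>T. SUP \<phi>\<in>U \<inter> Phi. ennreal \<bar>t \<phi>\<bar>) < ennreal \<epsilon>)"

lemma charge_integral_le_norm:
  "\<phi> \<in> Phi \<Longrightarrow> \<bar>charge_integral q \<phi>\<bar> \<le> norm q"
  unfolding norm_charge_def by (rule cSUP_upper[OF _ bdd_above_charge_integral])

lemma charge_integral_diff:
  assumes "\<phi> \<in> Phi"
  shows "charge_integral (p - q) \<phi> = charge_integral p \<phi> - charge_integral q \<phi>"
proof -
  have "charge_integral (p + - q) \<phi> = charge_integral p \<phi> + charge_integral (- q) \<phi>"
    by (rule charge_integral_add[where B = 1]) (use assms in \<open>auto simp: Phi_borel_measurable Phi_def\<close>)
  then show ?thesis by (simp add: charge_integral_uminus)
qed

lemma hyper_apply_eqI: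
  fixes q :: "nat \<Rightarrow> 'a::metric_space charge"
  assumes q: "(\<lambda>n. to_normed_completion (q n)) \<longlonglongrightarrow> t" and \<phi>: "\<phi> \<in> BL"
  shows "(\<lambda>n. charge_integral (q n) \<phi>) \<longlonglongrightarrow> hyper_apply t \<phi>"
proof -
  obtain a \<psi> where a: "a > 0" "\<psi> \<in> Phi" "\<phi> = (\<lambda>x. a * \<psi> x)"
    using \<phi> by (auto simp: BL_def)
  have "Cauchy q"
    using LIMSEQ_imp_Cauchy[OF q] by (simp add: Cauchy_def)
  have "Cauchy (\<lambda>n. charge_integral (q n) \<psi>)"
  proof (rule CauchyI)
    fix e :: real assume "0 < e"
    from CauchyD[OF \<open>Cauchy q\<close> this] obtain M where M: "\<forall>m\<ge>M. \<forall>n\<ge>M. norm (q m - q n) < e" ..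
    have "norm (charge_integral (q m) \<psi> - charge_integral (q n) \<psi>) < e" if "m \<ge> M" "n \<ge> M" for m n
      using charge_integral_le_norm[OF a(2), of "q m - q n"] M that
      by (simp add: charge_integral_diff[OF a(2)]) (meson order_le_less_trans)
    then show "\<exists>M. \<forall>m\<ge>M. \<forall>n\<ge>M. norm (charge_integral (q m) \<psi> - charge_integral (q n) \<psi>) < e" by blast
  qed
  then obtain l where l: "(\<lambda>n. charge_integral (q n) \<psi>) \<longlonglongrightarrow> l"
    using Cauchy_convergent convergent_def by blast
  have all: "(\<lambda>n. charge_integral (p n) \<phi>) \<longlonglongrightarrow> a * l"
    if p: "(\<lambda>n. to_normed_completion (p n)) \<longlonglongrightarrow> t" for p
  proof -
    have "(\<lambda>n. norm (to_normed_completion (p n) - to_normed_completion (q n))) \<longlonglongrightarrow> norm (t - t)"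
      by (intro tendsto_norm tendsto_diff p q)
    then have "(\<lambda>n. norm (p n - q n)) \<longlonglongrightarrow> 0"
      by (simp flip: dist_norm)
    then have "(\<lambda>n. charge_integral (p n) \<psi> - charge_integral (q n) \<psi>) \<longlonglongrightarrow> 0"
      by (rule Lim_null_comparison[rotated])
        (use charge_integral_le_norm[OF a(2)] in \<open>simp add: charge_integral_diff[OF a(2), symmetric]\<close>)
    from tendsto_add[OF this l] have "(\<lambda>n. charge_integral (p n) \<psi>) \<longlonglongrightarrow> l" by simp
    then show ?thesis
      unfolding a(3) charge_integral_cmult by (intro tendsto_mult tendsto_const)
  qed
  have "hyper_apply t \<phi> = a * l"
    unfolding hyper_apply_def
  proof (rule the_equality)
    fix r assume "\<forall>q. (\<lambda>n. to_normed_completion (q n)) \<longlonglongrightarrow> t \<longrightarrow> (\<lambda>n. charge_integral (q n) \<phi>) \<longlonglongrightarrow> r"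
    with q all[OF q] show "r = a * l" using LIMSEQ_unique by blast
  qed (use all in blast)
  then show ?thesis using all[OF q] by simp
qed

end

theory Submission
  imports Defs
begin

text \<open>
  The norm of a hypermeasure is its supremum norm as a function on \<open>\<Phi>\<close>. A charge is continuous on
  \<open>\<Phi>\<close> for pointwise convergence, because up to a set of small variation \<open>X\<close> is covered by finitely
  many small balls and the functions in \<open>\<Phi>\<close> are Lipschitz; finite nets transfer this to precompact
  sets. Conversely, \<open>(\<phi> - \<psi>) / 2 \<in> \<Phi>\<close> for \<open>\<phi>, \<psi> \<in> \<Phi>\<close>, so equiquasicontinuity amounts to uniform
  equicontinuity on the totally bounded space \<open>\<Phi>\<close>, and the Arzela-Ascoli argument applies.
\<close>

section \<open>Hypermeasures as linear functionals on \<open>Phi\<close>, and their norm\<close>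

lemma Phi_subset_BL: "Phi \<subseteq> BL"
proof
  fix \<phi> :: "'a::metric_space \<Rightarrow> real" assume "\<phi> \<in> Phi"
  then show "\<phi> \<in> BL"
    unfolding BL_def by (intro UN_I[of 1] image_eqI[of _ _ \<phi>]) auto
qed

text \<open>A difference of two members of \<open>Phi\<close> may double both the bound 1 and the
  Lipschitz constant 1; the factor 1/2 undoes this. It turns smallness of a functional near zero
  into closeness of its values at two nearby functions.\<close>

lemma Phi_half_diff:
  assumes "\<phi> \<in> Phi" "\<psi> \<in> Phi"
  shows "(\<lambda>x. (\<phi> x - \<psi> x) / 2) \<in> Phi"
proof -
  have half: "\<bar>(a - b) / 2\<bar> \<le> c" if "\<bar>a\<bar> \<le> c" "\<bar>b\<bar> \<le> c" for a b c :: real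
    using abs_triangle_ineq4[of a b] that by simp
  have "\<bar>(\<phi> x - \<psi> x) / 2 - (\<phi> y - \<psi> y) / 2\<bar> \<le> dist x y" for x y
  proof -
    have "\<bar>((\<phi> x - \<phi> y) - (\<psi> x - \<psi> y)) / 2\<bar> \<le> dist x y"
      using assms by (intro half) (simp_all add: Phi_def)
    moreover have "((\<phi> x - \<phi> y) - (\<psi> x - \<psi> y)) / 2 = (\<phi> x - \<psi> x) / 2 - (\<phi> y - \<psi> y) / 2"
      by argo
    ultimately show ?thesis by argo
  qed
  moreover have "\<bar>(\<phi> x - \<psi> x) / 2\<bar> \<le> 1" for x
    using assms by (intro half) (simp_all add: Phi_def)
  ultimately show ?thesis
    unfolding Phi_def by blast
qed

lemma charge_integral_half_diff:
  assumes "\<phi> \<in> Phi" "\<psi> \<in> Phi"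
  shows "charge_integral q (\<lambda>x. (\<phi> x - \<psi> x) / 2) = (charge_integral q \<phi> - charge_integral q \<psi>) / 2"
proof -
  have "integrable (pos_part s) \<phi>" "integrable (pos_part s) \<psi>" for s :: "'a charge"
    using assms by (auto intro!: integrable_pos_part[of _ 1] Phi_borel_measurable simp: Phi_def)
  then show ?thesis
    by (simp add: charge_integral_def field_simps)
qed

lemma hyper_apply_half_diff:
  assumes "\<phi> \<in> Phi" "\<psi> \<in> Phi"
  shows "hyper_apply t (\<lambda>x. (\<phi> x - \<psi> x) / 2) = (hyper_apply t \<phi> - hyper_apply t \<psi>) / 2"
proof -
  obtain q where q: "(\<lambda>n. to_normed_completion (q n)) \<longlonglongrightarrow> t"
    by (rule normed_completion_seq)
  have "(\<lambda>n. (charge_integral (q n) \<phi> - charge_integral (q n) \<psi>) / 2)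
      \<longlonglongrightarrow> (hyper_apply t \<phi> - hyper_apply t \<psi>) / 2"
    using assms Phi_subset_BL by (intro tendsto_intros hyper_apply_eqI[OF q]) auto
  moreover have "(\<lambda>n. (charge_integral (q n) \<phi> - charge_integral (q n) \<psi>) / 2)
      \<longlonglongrightarrow> hyper_apply t (\<lambda>x. (\<phi> x - \<psi> x) / 2)"
    using hyper_apply_eqI[OF q, of "\<lambda>x. (\<phi> x - \<psi> x) / 2"] Phi_half_diff[OF assms] Phi_subset_BL
    by (auto simp: charge_integral_half_diff[OF assms])
  ultimately show ?thesis by (rule LIMSEQ_unique[symmetric])
qed

text \<open>Termwise differences of charges approximating \<open>s\<close> and \<open>t\<close>
  approximate \<open>s - t\<close>, so the identity for charges passes to the limit.\<close>

lemma hyper_apply_diff: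
  assumes "\<phi> \<in> Phi"
  shows "hyper_apply (s - t) \<phi> = hyper_apply s \<phi> - hyper_apply t \<phi>"
proof -
  have \<phi>: "\<phi> \<in> BL" using assms Phi_subset_BL by auto
  obtain p where p: "(\<lambda>n. to_normed_completion (p n)) \<longlonglongrightarrow> s"
    by (rule normed_completion_seq)
  obtain q where q: "(\<lambda>n. to_normed_completion (q n)) \<longlonglongrightarrow> t"
    by (rule normed_completion_seq)
  have "(\<lambda>n. to_normed_completion (p n - q n)) \<longlonglongrightarrow> s - t"
    unfolding linear_diff[OF linear_to_normed_completion] by (intro tendsto_diff p q)
  from hyper_apply_eqI[OF this \<phi>]
  have "(\<lambda>n. charge_integral (p n) \<phi> - charge_integral (q n) \<phi>) \<longlonglongrightarrow> hyper_apply (s - t) \<phi>"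
    by (simp add: charge_integral_diff[OF assms])
  moreover have "(\<lambda>n. charge_integral (p n) \<phi> - charge_integral (q n) \<phi>)
      \<longlonglongrightarrow> hyper_apply s \<phi> - hyper_apply t \<phi>"
    by (intro tendsto_diff hyper_apply_eqI p q \<phi>)
  ultimately show ?thesis by (rule LIMSEQ_unique)
qed

lemma hyper_apply_to_normed_completion:
  assumes "\<phi> \<in> Phi"
  shows "hyper_apply (to_normed_completion q) \<phi> = charge_integral q \<phi>"
  using hyper_apply_eqI[of "\<lambda>_. q" "to_normed_completion q" \<phi>] assms Phi_subset_BL
  by (auto simp: LIMSEQ_const_iff)

lemma hyper_apply_le_norm:
  assumes "\<phi> \<in> Phi"
  shows "\<bar>hyper_apply t \<phi>\<bar> \<le> norm t"
proof -
  obtain q where q: "(\<lambda>n. to_normed_completion (q n)) \<longlonglongrightarrow> t"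
    by (rule normed_completion_seq)
  have "(\<lambda>n. \<bar>charge_integral (q n) \<phi>\<bar>) \<longlonglongrightarrow> \<bar>hyper_apply t \<phi>\<bar>"
    using assms Phi_subset_BL by (intro tendsto_rabs hyper_apply_eqI q) auto
  moreover have "(\<lambda>n. norm (q n)) \<longlonglongrightarrow> norm t"
    using tendsto_norm[OF q] by simp
  ultimately show ?thesis
    by (rule LIMSEQ_le) (use charge_integral_le_norm[OF assms] in auto)
qed

text \<open>Together with \<open>hyper_apply_le_norm\<close> this identifies the norm of the
  completion, defined abstractly as a limit of norms, with the supremum over \<open>Phi\<close>.
  From here on norms of hypermeasures are estimated one function at a time.\<close>

lemma norm_hypermeasure_le:
  fixes t :: "'a::metric_space hypermeasure"
  assumes B: "\<And>\<phi>. \<phi> \<in> Phi \<Longrightarrow> \<bar>hyper_apply t \<phi>\<bar> \<le> B"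
  shows "norm t \<le> B"
proof -
  obtain q where q: "(\<lambda>n. to_normed_completion (q n)) \<longlonglongrightarrow> t"
    by (rule normed_completion_seq)
  \<comment> \<open>The bound \<open>B\<close> is known for \<open>t\<close> only; passing to
    \<open>q n\<close> costs the distance from \<open>q n\<close> to \<open>t\<close>, which
    vanishes in the limit.\<close>
  have le: "norm (q n) \<le> B + norm (to_normed_completion (q n) - t)" for n
    unfolding norm_charge_def
  proof (rule cSUP_least)
    show "(Phi :: ('a \<Rightarrow> real) set) \<noteq> {}" using zero_in_Phi by auto
    fix \<phi> :: "'a \<Rightarrow> real" assume \<phi>: "\<phi> \<in> Phi"
    show "\<bar>charge_integral (q n) \<phi>\<bar> \<le> B + norm (to_normed_completion (q n) - t)"
      using hyper_apply_le_norm[OF \<phi>, of "to_normed_completion (q n) - t"] B[OF \<phi>]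
      by (simp add: hyper_apply_diff[OF \<phi>] hyper_apply_to_normed_completion[OF \<phi>])
  qed
  have "(\<lambda>n. norm (q n)) \<longlonglongrightarrow> norm t"
    using tendsto_norm[OF q] by simp
  moreover have "(\<lambda>n. B + norm (to_normed_completion (q n) - t)) \<longlonglongrightarrow> B + norm (t - t)"
    by (intro tendsto_intros q)
  ultimately have "norm t \<le> B + norm (t - t)"
    by (rule LIMSEQ_le) (use le in auto)
  then show ?thesis by simp
qed

section \<open>Equiquasicontinuity in terms of finitely many points\<close>

text \<open>A basic open set of the product topology restricts only finitely many coordinates, so
  one tolerance \<delta> serves all of them.\<close>

lemma fun_open_contains_box:
  fixes f :: "'a \<Rightarrow> real"
  assumes "open U" "f \<in> U"
  obtains F \<delta> where "finite F" "\<delta> > 0" "\<And>g. (\<And>x. x \<in> F \<Longrightarrow> \<bar>g x - f x\<bar> < \<delta>) \<Longrightarrow> g \<in> U"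
proof -
  obtain X where X: "f \<in> Pi\<^sub>E UNIV X" "\<And>i. open (X i)" "finite {i. X i \<noteq> UNIV}" "Pi\<^sub>E UNIV X \<subseteq> U"
    using product_topology_open_contains_basis[of "\<lambda>_. euclidean" UNIV U f] assms
    by (auto simp: open_fun_def)
  define F where "F = {i. X i \<noteq> UNIV}"
  have "\<exists>e>0. \<forall>y. \<bar>y - f i\<bar> < e \<longrightarrow> y \<in> X i" for i
    using X(1) X(2)[of i] by (auto simp: open_dist dist_real_def)
  then obtain e where e: "\<And>i. e i > 0" "\<And>i y. \<bar>y - f i\<bar> < e i \<Longrightarrow> y \<in> X i"
    by metis
  \<comment> \<open>The inserted 1 keeps the minimum defined and positive when \<open>F\<close> is
    empty.\<close>
  define \<delta> where "\<delta> = Min (insert 1 (e ` F))"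
  have F: "finite F" using X(3) by (simp add: F_def)
  have "\<delta> > 0" using F e(1) by (auto simp: \<delta>_def)
  moreover have "g \<in> U" if g: "\<And>x. x \<in> F \<Longrightarrow> \<bar>g x - f x\<bar> < \<delta>" for g
  proof -
    have "g i \<in> X i" for i
    proof (cases "i \<in> F")
      case True
      then have "\<delta> \<le> e i" using F by (simp add: \<delta>_def)
      with g[OF True] show ?thesis by (intro e(2)) linarith
    qed (simp add: F_def)
    then show ?thesis using X(4) by auto
  qed
  ultimately show ?thesis using that F by blast
qed

lemma open_fun_box:
  assumes "finite F"
  shows "open {\<phi> :: 'a \<Rightarrow> real. \<forall>x\<in>F. \<bar>\<phi> x\<bar> < \<delta>}"
proof -
  have "open {\<phi> :: 'a \<Rightarrow> real. \<bar>\<phi> x\<bar> < \<delta>}" for x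
    by (intro open_Collect_less continuous_intros continuous_on_product_coordinates)
  moreover have "{\<phi> :: 'a \<Rightarrow> real. \<forall>x\<in>F. \<bar>\<phi> x\<bar> < \<delta>} = (\<Inter>x\<in>F. {\<phi>. \<bar>\<phi> x\<bar> < \<delta>})"
    by auto
  ultimately show ?thesis using assms by auto
qed

text \<open>Boxes over finite sets form a neighbourhood base at zero, and a supremum is bounded once
  each of its members is. The weak inequality is harmless because \<epsilon> is arbitrary.\<close>

lemma equiquasicontinuous_iff:
  fixes S :: "(('a::metric_space \<Rightarrow> real) \<Rightarrow> real) set"
  shows "equiquasicontinuous S \<longleftrightarrow>
    (\<forall>\<epsilon>>0. \<exists>F \<delta>. finite F \<and> \<delta> > 0 \<and> (\<forall>t\<in>S. \<forall>\<phi>\<in>Phi. (\<forall>x\<in>F. \<bar>\<phi> x\<bar> < \<delta>) \<longrightarrow> \<bar>t \<phi>\<bar> \<le> \<epsilon>))"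
    (is "_ \<longleftrightarrow> (\<forall>\<epsilon>>0. ?Q \<epsilon>)")
proof (intro iffI allI impI)
  fix \<epsilon> :: real assume "equiquasicontinuous S" "\<epsilon> > 0"
  then obtain U :: "('a \<Rightarrow> real) set" where U: "(\<lambda>_. 0) \<in> interior U"
    and sup: "(SUP t\<in>S. SUP \<phi>\<in>U \<inter> Phi. ennreal \<bar>t \<phi>\<bar>) < ennreal \<epsilon>"
    unfolding equiquasicontinuous_def by blast
  obtain F \<delta> where F: "finite F" "\<delta> > 0"
    "\<And>g. (\<And>x. x \<in> F \<Longrightarrow> \<bar>g x - 0\<bar> < \<delta>) \<Longrightarrow> g \<in> interior U"
    using fun_open_contains_box[OF open_interior U] by metis
  have "\<bar>t \<phi>\<bar> \<le> \<epsilon>" if t: "t \<in> S" and \<phi>: "\<phi> \<in> Phi" "\<forall>x\<in>F. \<bar>\<phi> x\<bar> < \<delta>" for t \<phi>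
  proof -
    have "\<phi> \<in> U" using F(3)[of \<phi>] \<phi>(2) interior_subset by auto
    then have "ennreal \<bar>t \<phi>\<bar> \<le> (SUP \<phi>\<in>U \<inter> Phi. ennreal \<bar>t \<phi>\<bar>)"
      using \<phi>(1) by (intro SUP_upper) auto
    also have "\<dots> \<le> (SUP t\<in>S. SUP \<phi>\<in>U \<inter> Phi. ennreal \<bar>t \<phi>\<bar>)"
      using t by (intro SUP_upper)
    finally have "ennreal \<bar>t \<phi>\<bar> \<le> ennreal \<epsilon>"
      using sup by (meson order_le_less_trans less_imp_le)
    then show ?thesis using \<open>\<epsilon> > 0\<close> by simp
  qed
  with F(1,2) show "?Q \<epsilon>" by blast
next
  assume Q: "\<forall>\<epsilon>>0. ?Q \<epsilon>"
  show "equiquasicontinuous S"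
    unfolding equiquasicontinuous_def
  proof (intro allI impI)
    fix \<epsilon> :: real assume "\<epsilon> > 0"
    \<comment> \<open>Pointwise bounds give only a weak bound on the supremum; starting from half of
      \<epsilon> restores the strict one.\<close>
    then have "?Q (\<epsilon> / 2)" by (intro Q[rule_format]) simp
    then obtain F \<delta> where F: "finite F" "\<delta> > 0"
      "\<And>t \<phi>. t \<in> S \<Longrightarrow> \<phi> \<in> Phi \<Longrightarrow> \<forall>x\<in>F. \<bar>\<phi> x\<bar> < \<delta> \<Longrightarrow> \<bar>t \<phi>\<bar> \<le> \<epsilon> / 2" by blast
    define U where "U = {\<phi> :: 'a \<Rightarrow> real. \<forall>x\<in>F. \<bar>\<phi> x\<bar> < \<delta>}"
    have "(\<lambda>_. 0) \<in> interior U"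
      using open_fun_box[OF F(1), of \<delta>] F(2) by (simp add: U_def interior_open)
    moreover have "(SUP t\<in>S. SUP \<phi>\<in>U \<inter> Phi. ennreal \<bar>t \<phi>\<bar>) \<le> ennreal (\<epsilon> / 2)"
      using F(3) by (intro SUP_least ennreal_leI) (auto simp: U_def)
    moreover have "ennreal (\<epsilon> / 2) < ennreal \<epsilon>"
      using \<open>\<epsilon> > 0\<close> by (simp add: ennreal_less_iff)
    ultimately show "\<exists>U. (\<lambda>_. 0) \<in> interior U \<and> (SUP t\<in>S. SUP \<phi>\<in>U \<inter> Phi. ennreal \<bar>t \<phi>\<bar>) < ennreal \<epsilon>"
      by (meson order_le_less_trans)
  qed
qed

section \<open>Quasicontinuity of finite measures and of single hypermeasures\<close>

text \<open>Balls of radius \<delta> around a countable dense set cover the space, so by continuity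
  from above finitely many of them miss only a set of small measure. A function in
  \<open>Phi\<close> that is small at their centres is small on their union by the Lipschitz
  condition, and is bounded by 1 elsewhere.\<close>

lemma finite_measure_quasicontinuous:
  fixes M :: "'a::{metric_space, second_countable_topology} measure"
  assumes M: "finite_measure M" "sets M = sets borel" and "\<epsilon> > 0"
  obtains F \<delta> where "finite F" "\<delta> > 0"
    "\<And>\<phi>. \<phi> \<in> Phi \<Longrightarrow> \<forall>x\<in>F. \<bar>\<phi> x\<bar> < \<delta> \<Longrightarrow> \<bar>integral\<^sup>L M \<phi>\<bar> \<le> \<epsilon>"
proof -
  interpret finite_measure M by (rule M(1))
  have space: "space M = UNIV" using sets_eq_imp_space_eq[OF M(2)] by simp
  obtain D :: "'a set" where D: "countable D" "\<And>X. open X \<Longrightarrow> X \<noteq> {} \<Longrightarrow> \<exists>d\<in>D. d \<in> X"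
    using countable_dense_setE by blast
  have "D \<noteq> {}" using D(2)[of UNIV] by auto
  define d where "d = from_nat_into D"
  define m where "m = measure M UNIV"
  have m: "m \<ge> 0" by (simp add: m_def)
  \<comment> \<open>Chosen so that the bound \<open>2 * \<delta>\<close> integrates to at most half
    of \<epsilon>; the summand 1 avoids division by zero for the zero measure.\<close>
  define \<delta> where "\<delta> = \<epsilon> / (4 * (m + 1))"
  have \<delta>: "\<delta> > 0" using \<open>\<epsilon> > 0\<close> m by (simp add: \<delta>_def)
  have \<delta>m: "2 * \<delta> * m \<le> \<epsilon> / 2"
  proof -
    have "2 * \<delta> * m \<le> 2 * \<delta> * (m + 1)" using \<delta> by simp
    also have "\<dots> = \<epsilon> / 2" using m by (simp add: \<delta>_def field_simps)
    finally show ?thesis .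
  qed
  define A where "A n = UNIV - (\<Union>i<n. ball (d i) \<delta>)" for n
  have A: "A n \<in> sets M" for n by (simp add: A_def M(2))
  have "\<exists>i. x \<in> ball (d i) \<delta>" for x
  proof -
    obtain y where "y \<in> D" "y \<in> ball x \<delta>" using D(2)[of "ball x \<delta>"] \<delta> by auto
    then show ?thesis
      using from_nat_into_surj[OF D(1)] by (metis d_def dist_commute mem_ball)
  qed
  then have "(\<Inter>n. A n) = {}" by (auto simp: A_def) blast
  moreover have "(\<lambda>n. measure M (A n)) \<longlonglongrightarrow> measure M (\<Inter>n. A n)"
    using A by (intro finite_Lim_measure_decseq) (fastforce simp: A_def decseq_def)+
  ultimately have "(\<lambda>n. measure M (A n)) \<longlonglongrightarrow> 0" by simp
  from LIMSEQ_D[OF this, of "\<epsilon> / 2"] \<open>\<epsilon> > 0\<close> obtain n where n: "measure M (A n) < \<epsilon> / 2"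
    by auto
  show ?thesis
  proof (rule that[of "d ` {..<n}" \<delta>])
    fix \<phi> :: "'a \<Rightarrow> real" assume \<phi>: "\<phi> \<in> Phi" "\<forall>x\<in>d ` {..<n}. \<bar>\<phi> x\<bar> < \<delta>"
    have int: "integrable M \<phi>"
      by (rule integrable_const_bound[where B = 1])
        (use \<phi>(1) Phi_borel_measurable[OF \<phi>(1)] in \<open>auto simp: Phi_def measurable_cong_sets[OF M(2) refl]\<close>)
    have int': "integrable M (\<lambda>x. 2 * \<delta> + indicator (A n) x)"
      using A[of n] by (intro Bochner_Integration.integrable_add integrable_real_indicator)
        (auto simp: emeasure_eq_measure)
    \<comment> \<open>Within a ball, one \<delta> comes from the value at the centre and one from
      the distance to it; on the uncovered set \<open>A n\<close> the indicator supplies the bound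
      1.\<close>
    have le: "\<bar>\<phi> x\<bar> \<le> 2 * \<delta> + indicator (A n) x" for x
    proof (cases "x \<in> A n")
      case True
      have "\<bar>\<phi> x\<bar> \<le> 1" using \<phi>(1) by (simp add: Phi_def)
      then show ?thesis using True \<delta> by simp
    next
      case False
      then obtain i where i: "i < n" "dist (d i) x < \<delta>" by (auto simp: A_def)
      have "\<bar>\<phi> (d i)\<bar> < \<delta>" using \<phi>(2) i by auto
      moreover have "\<bar>\<phi> (d i) - \<phi> x\<bar> \<le> dist (d i) x" using \<phi>(1) by (simp add: Phi_def)
      ultimately show ?thesis using i False by simp
    qed
    have "\<bar>integral\<^sup>L M \<phi>\<bar> \<le> (\<integral>x. \<bar>\<phi> x\<bar> \<partial>M)"
      by (rule integral_abs_bound)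
    also have "\<dots> \<le> (\<integral>x. 2 * \<delta> + indicator (A n) x \<partial>M)"
      by (intro integral_mono integrable_abs int int' le)
    also have "\<dots> = 2 * \<delta> * m + measure M (A n)"
      using A[of n] by (subst Bochner_Integration.integral_add)
        (auto simp: emeasure_eq_measure m_def space)
    also have "\<dots> \<le> \<epsilon>" using n \<delta>m by linarith
    finally show "\<bar>integral\<^sup>L M \<phi>\<bar> \<le> \<epsilon>" .
  qed (use \<delta> in auto)
qed

text \<open>Charges are dense in the completion. One third of \<epsilon> pays for replacing
  \<open>t\<close> by a charge \<open>q\<close>, uniformly over \<open>Phi\<close>, and one third
  for each part of the Jordan decomposition of \<open>q\<close>.\<close>

lemma hyper_apply_quasicontinuous:
  fixes t :: "'a::{metric_space, second_countable_topology} hypermeasure"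
  assumes "\<epsilon> > 0"
  obtains F \<delta> where "finite F" "\<delta> > 0"
    "\<And>\<phi>. \<phi> \<in> Phi \<Longrightarrow> \<forall>x\<in>F. \<bar>\<phi> x\<bar> < \<delta> \<Longrightarrow> \<bar>hyper_apply t \<phi>\<bar> \<le> \<epsilon>"
proof -
  have e: "\<epsilon> / 3 > 0" using assms by simp
  obtain q where q: "norm (t - to_normed_completion q) < \<epsilon> / 3"
  proof -
    obtain X where "(\<lambda>n. to_normed_completion (X n)) \<longlonglongrightarrow> t"
      by (rule normed_completion_seq)
    from LIMSEQ_D[OF this e] show ?thesis using that by (metis norm_minus_commute order_refl)
  qed
  obtain F \<delta> where F: "finite F" "\<delta> > 0"
    "\<And>\<phi>. \<phi> \<in> Phi \<Longrightarrow> \<forall>x\<in>F. \<bar>\<phi> x\<bar> < \<delta> \<Longrightarrow> \<bar>integral\<^sup>L (pos_part q) \<phi>\<bar> \<le> \<epsilon> / 3"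
    using finite_measure_quasicontinuous[OF finite_measure_pos_part sets_pos_part e] by metis
  obtain G \<eta> where G: "finite G" "\<eta> > 0"
    "\<And>\<phi>. \<phi> \<in> Phi \<Longrightarrow> \<forall>x\<in>G. \<bar>\<phi> x\<bar> < \<eta> \<Longrightarrow> \<bar>integral\<^sup>L (pos_part (- q)) \<phi>\<bar> \<le> \<epsilon> / 3"
    using finite_measure_quasicontinuous[OF finite_measure_pos_part sets_pos_part e] by metis
  show ?thesis
  proof (rule that[of "F \<union> G" "min \<delta> \<eta>"])
    fix \<phi> :: "'a \<Rightarrow> real" assume \<phi>: "\<phi> \<in> Phi" "\<forall>x\<in>F \<union> G. \<bar>\<phi> x\<bar> < min \<delta> \<eta>"
    have "\<bar>hyper_apply t \<phi> - charge_integral q \<phi>\<bar> < \<epsilon> / 3"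
      using hyper_apply_le_norm[OF \<phi>(1), of "t - to_normed_completion q"] q
      by (simp add: hyper_apply_diff[OF \<phi>(1)] hyper_apply_to_normed_completion[OF \<phi>(1)])
    moreover have "\<bar>integral\<^sup>L (pos_part q) \<phi>\<bar> \<le> \<epsilon> / 3" "\<bar>integral\<^sup>L (pos_part (- q)) \<phi>\<bar> \<le> \<epsilon> / 3"
      using F(3)[OF \<phi>(1)] G(3)[OF \<phi>(1)] \<phi>(2) by auto
    ultimately show "\<bar>hyper_apply t \<phi>\<bar> \<le> \<epsilon>"
      unfolding charge_integral_def by linarith
  qed (use F G in auto)
qed

text \<open>Finitely many conditions combine by uniting the point sets and taking the smaller
  tolerance. It will be applied to the centres of a finite cover of a compact set.\<close>

lemma finite_hyper_apply_quasicontinuous: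
  fixes K :: "'a::{metric_space, second_countable_topology} hypermeasure set"
  assumes "finite K" "\<epsilon> > 0"
  shows "\<exists>F \<delta>. finite F \<and> \<delta> > 0 \<and>
    (\<forall>t\<in>K. \<forall>\<phi>\<in>Phi. (\<forall>x\<in>F. \<bar>\<phi> x\<bar> < \<delta>) \<longrightarrow> \<bar>hyper_apply t \<phi>\<bar> \<le> \<epsilon>)"
  using assms(1)
proof (induction rule: finite_induct)
  case empty
  show ?case by (intro exI[of _ "{}"] exI[of _ 1]) auto
next
  case (insert t K)
  then obtain F \<delta> where F: "finite F" "\<delta> > 0"
    "\<And>s \<phi>. s \<in> K \<Longrightarrow> \<phi> \<in> Phi \<Longrightarrow> \<forall>x\<in>F. \<bar>\<phi> x\<bar> < \<delta> \<Longrightarrow> \<bar>hyper_apply s \<phi>\<bar> \<le> \<epsilon>" by blast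
  obtain G \<eta> where G: "finite G" "\<eta> > 0"
    "\<And>\<phi>. \<phi> \<in> Phi \<Longrightarrow> \<forall>x\<in>G. \<bar>\<phi> x\<bar> < \<eta> \<Longrightarrow> \<bar>hyper_apply t \<phi>\<bar> \<le> \<epsilon>"
    using hyper_apply_quasicontinuous[OF assms(2)] by metis
  show ?case
    by (intro exI[of _ "F \<union> G"] exI[of _ "min \<delta> \<eta>"]) (use F G in auto)
qed

section \<open>Finite nets by the Arzela-Ascoli argument\<close>

text \<open>Rounding each coordinate down to a multiple of \<delta> leaves finitely many patterns,
  and members with the same pattern differ by less than \<delta> in every coordinate. The abstract
  \<open>g\<close> allows two uses: functions evaluated at points, and hypermeasures evaluated at
  functions.\<close>

lemma bounded_finite_coordinates_net:
  fixes g :: "'b \<Rightarrow> 'i \<Rightarrow> real"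
  assumes F: "finite F" and \<delta>: "\<delta> > 0" and B: "\<And>b i. b \<in> S \<Longrightarrow> i \<in> F \<Longrightarrow> \<bar>g b i\<bar> \<le> B"
  obtains N where "finite N" "N \<subseteq> S" "\<And>b. b \<in> S \<Longrightarrow> \<exists>c\<in>N. \<forall>i\<in>F. \<bar>g b i - g c i\<bar> < \<delta>"
proof -
  define h where "h b = restrict (\<lambda>i. \<lfloor>g b i / \<delta>\<rfloor>) F" for b
  have "h ` S \<subseteq> PiE F (\<lambda>_. {\<lfloor>- B / \<delta>\<rfloor>..\<lfloor>B / \<delta>\<rfloor>})"
  proof (clarsimp simp: h_def, intro conjI floor_mono)
    fix b i assume "b \<in> S" "i \<in> F"
    from B[OF this] have "- B \<le> g b i" "g b i \<le> B" by auto
    then show "- (B / \<delta>) \<le> g b i / \<delta>" "g b i / \<delta> \<le> B / \<delta>"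
      using \<delta> by (auto simp: field_simps)
  qed
  then have "finite (h ` S)"
    by (rule finite_subset) (intro finite_PiE F finite_atLeastAtMost_int)
  \<comment> \<open>One representative per pattern, taken from \<open>S\<close> itself: net members
    must inherit the properties of \<open>S\<close>.\<close>
  then obtain N where N: "N \<subseteq> S" "finite N" "h ` S = h ` N"
    by (rule finite_subset_image[OF _ subset_refl, elim_format]) blast
  have "\<exists>c\<in>N. \<forall>i\<in>F. \<bar>g b i - g c i\<bar> < \<delta>" if "b \<in> S" for b
  proof -
    obtain c where c: "c \<in> N" "h b = h c" using N(3) \<open>b \<in> S\<close> by (metis imageE imageI)
    have "\<bar>g b i - g c i\<bar> < \<delta>" if "i \<in> F" for i
    proof -
      have "\<lfloor>g b i / \<delta>\<rfloor> = \<lfloor>g c i / \<delta>\<rfloor>"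
        using c(2) that by (metis h_def restrict_apply')
      then have "\<bar>g b i / \<delta> - g c i / \<delta>\<bar> < 1" by linarith
      then have "\<bar>(g b i - g c i) / \<delta>\<bar> < 1" by (simp add: diff_divide_distrib)
      then show ?thesis using \<delta> by (simp add: abs_divide)
    qed
    with c(1) show ?thesis by blast
  qed
  with that N show ?thesis by blast
qed

text \<open>Equiquasicontinuity reduces \<open>Phi\<close> to a finite set \<open>P\<close> of test
  functions, uniformly over \<open>T\<close>. Boundedness then makes the values on \<open>P\<close>
  range over a bounded set of vectors, which has a finite net.\<close>

lemma equiquasicontinuous_imp_net:
  fixes T :: "'a::metric_space hypermeasure set"
  assumes T: "bounded T" and eq: "equiquasicontinuous (hyper_apply ` T)" and "\<epsilon> > 0"
  obtains N where "finite N" "N \<subseteq> T" "\<And>t. t \<in> T \<Longrightarrow> \<exists>s\<in>N. norm (t - s) \<le> \<epsilon>"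
proof -
  \<comment> \<open>Replacing a function by its neighbour in \<open>P\<close> costs two fifths of
    \<epsilon> for \<open>t\<close> and again for \<open>s\<close>, since only half the difference
    lies in \<open>Phi\<close>; comparing \<open>t\<close> with \<open>s\<close> on \<open>P\<close>
    costs the last fifth.\<close>
  have e: "\<epsilon> / 5 > 0" using \<open>\<epsilon> > 0\<close> by simp
  obtain F \<delta> where F: "finite F" "\<delta> > 0"
    "\<And>t \<phi>. t \<in> T \<Longrightarrow> \<phi> \<in> Phi \<Longrightarrow> \<forall>x\<in>F. \<bar>\<phi> x\<bar> < \<delta> \<Longrightarrow> \<bar>hyper_apply t \<phi>\<bar> \<le> \<epsilon> / 5"
    using eq e unfolding equiquasicontinuous_iff by (metis image_eqI)
  \<comment> \<open>With mesh \<open>2 * \<delta>\<close> the half difference of a function and its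
    neighbour is below \<delta> on \<open>F\<close>.\<close>
  obtain P where P: "finite P" "P \<subseteq> Phi"
    "\<And>\<phi>. \<phi> \<in> Phi \<Longrightarrow> \<exists>\<psi>\<in>P. \<forall>x\<in>F. \<bar>\<phi> x - \<psi> x\<bar> < 2 * \<delta>"
    by (rule bounded_finite_coordinates_net[OF F(1), of "2 * \<delta>" Phi "\<lambda>\<phi>. \<phi>" 1])
      (use F(2) in \<open>auto simp: Phi_def\<close>)
  obtain B where B: "\<And>t. t \<in> T \<Longrightarrow> norm t \<le> B"
    using T unfolding bounded_iff by blast
  have "\<bar>hyper_apply t \<phi>\<bar> \<le> B" if "t \<in> T" "\<phi> \<in> P" for t \<phi>
    using hyper_apply_le_norm[of \<phi> t] B[of t] P(2) that by force
  then obtain N where N: "finite N" "N \<subseteq> T"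
    "\<And>t. t \<in> T \<Longrightarrow> \<exists>s\<in>N. \<forall>\<phi>\<in>P. \<bar>hyper_apply t \<phi> - hyper_apply s \<phi>\<bar> < \<epsilon> / 5"
    using bounded_finite_coordinates_net[OF P(1) e, of T hyper_apply B] by metis
  have "\<exists>s\<in>N. norm (t - s) \<le> \<epsilon>" if t: "t \<in> T" for t
  proof -
    obtain s where s: "s \<in> N" "\<forall>\<phi>\<in>P. \<bar>hyper_apply t \<phi> - hyper_apply s \<phi>\<bar> < \<epsilon> / 5"
      using N(3)[OF t] by blast
    have "\<bar>hyper_apply (t - s) \<phi>\<bar> \<le> \<epsilon>" if \<phi>: "\<phi> \<in> Phi" for \<phi>
    proof -
      obtain \<psi> where \<psi>: "\<psi> \<in> P" "\<forall>x\<in>F. \<bar>\<phi> x - \<psi> x\<bar> < 2 * \<delta>"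
        using P(3)[OF \<phi>] by blast
      then have "\<psi> \<in> Phi" using P(2) by auto
      have "\<bar>hyper_apply u \<phi> - hyper_apply u \<psi>\<bar> \<le> 2 * (\<epsilon> / 5)" if "u \<in> T" for u
        using F(3)[OF that Phi_half_diff[OF \<phi> \<open>\<psi> \<in> Phi\<close>]] \<psi>(2)
        by (simp add: hyper_apply_half_diff[OF \<phi> \<open>\<psi> \<in> Phi\<close>] mult.commute)
      \<comment> \<open>The estimate applies to \<open>s\<close> as well because the net
        \<open>N\<close> lies inside \<open>T\<close>.\<close>
      from this[of t] this[of s] have "\<bar>hyper_apply t \<phi> - hyper_apply t \<psi>\<bar> \<le> 2 * (\<epsilon> / 5)"
        "\<bar>hyper_apply s \<phi> - hyper_apply s \<psi>\<bar> \<le> 2 * (\<epsilon> / 5)"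
        using t s(1) N(2) by auto
      moreover have "\<bar>hyper_apply t \<psi> - hyper_apply s \<psi>\<bar> < \<epsilon> / 5" using s(2) \<psi>(1) by blast
      ultimately show ?thesis
        unfolding hyper_apply_diff[OF \<phi>] by linarith
    qed
    then show ?thesis using s(1) norm_hypermeasure_le by blast
  qed
  with that N show ?thesis by blast
qed

section \<open>Compactness of the closure through total boundedness\<close>

theorem theorem2:
  fixes T :: "'a::polish_space hypermeasure set"
  shows "compact (closure T) \<longleftrightarrow> bounded T \<and> equiquasicontinuous (hyper_apply ` T)"
proof (intro iffI conjI)
  assume C: "compact (closure T)"
  then show "bounded T"
    using compact_imp_bounded bounded_subset closure_subset by blast
  show "equiquasicontinuous (hyper_apply ` T)"
    unfolding equiquasicontinuous_iff
  proof (intro allI impI)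
    fix \<epsilon> :: real assume "\<epsilon> > 0"
    then have e: "\<epsilon> / 2 > 0" by simp
    \<comment> \<open>The centres are arbitrary hypermeasures, possibly outside \<open>T\<close>;
      each is quasicontinuous on its own, so the finite case applies to them.\<close>
    obtain K where K: "finite K" "closure T \<subseteq> (\<Union>s\<in>K. ball s (\<epsilon> / 2))"
      using C e unfolding compact_eq_totally_bounded by blast
    obtain F \<delta> where F: "finite F" "\<delta> > 0"
      "\<And>s \<phi>. s \<in> K \<Longrightarrow> \<phi> \<in> Phi \<Longrightarrow> \<forall>x\<in>F. \<bar>\<phi> x\<bar> < \<delta> \<Longrightarrow> \<bar>hyper_apply s \<phi>\<bar> \<le> \<epsilon> / 2"
      using finite_hyper_apply_quasicontinuous[OF K(1) e] by blast
    have "\<bar>hyper_apply t \<phi>\<bar> \<le> \<epsilon>" if t: "t \<in> T" and \<phi>: "\<phi> \<in> Phi" "\<forall>x\<in>F. \<bar>\<phi> x\<bar> < \<delta>" for t \<phi>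
    proof -
      obtain s where s: "s \<in> K" "norm (s - t) < \<epsilon> / 2"
        using K(2) t closure_subset[of T] by (auto simp: dist_norm subset_iff)
      then show ?thesis
        using hyper_apply_le_norm[OF \<phi>(1), of "s - t"] F(3)[OF s(1) \<phi>]
        unfolding hyper_apply_diff[OF \<phi>(1)] by linarith
    qed
    with F(1,2) show "\<exists>F \<delta>. finite F \<and> \<delta> > 0 \<and>
        (\<forall>t\<in>hyper_apply ` T. \<forall>\<phi>\<in>Phi. (\<forall>x\<in>F. \<bar>\<phi> x\<bar> < \<delta>) \<longrightarrow> \<bar>t \<phi>\<bar> \<le> \<epsilon>)"
      by blast
  qed
next
  assume T: "bounded T \<and> equiquasicontinuous (hyper_apply ` T)"
  show "compact (closure T)"
    unfolding compact_eq_totally_bounded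
  proof (intro conjI allI impI)
    \<comment> \<open>The completion is a Banach space, so its closed subsets are complete.\<close>
    show "complete (closure T)" by (simp add: complete_eq_closed)
    fix \<epsilon> :: real assume "\<epsilon> > 0"
    then have e: "\<epsilon> / 2 > 0" by simp
    obtain N where N: "finite N" "N \<subseteq> T" "\<And>t. t \<in> T \<Longrightarrow> \<exists>s\<in>N. norm (t - s) \<le> \<epsilon> / 2"
      using equiquasicontinuous_imp_net[OF _ _ e] T by metis
    \<comment> \<open>A finite union of closed balls is closed and hence contains the closure; the
      radius of half \<epsilon> leaves room to return to open balls.\<close>
    have "T \<subseteq> (\<Union>s\<in>N. cball s (\<epsilon> / 2))"
      using N(3) by (fastforce simp: dist_norm norm_minus_commute)
    then have "closure T \<subseteq> (\<Union>s\<in>N. cball s (\<epsilon> / 2))"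
      by (rule closure_minimal) (intro closed_UN N(1) ballI closed_cball)
    also have "\<dots> \<subseteq> (\<Union>s\<in>N. ball s \<epsilon>)"
      using \<open>\<epsilon> > 0\<close> by (intro UN_mono) auto
    finally show "\<exists>k. finite k \<and> closure T \<subseteq> (\<Union>x\<in>k. ball x \<epsilon>)"
      using N(1) by blast
  qed
qed

end
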